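(* For every $f\in C_b(\mathbb{R}^d)$, $$\lim_{t\to+\infty}\int_{\mathbb{R}^d}f\,\mu_t(dx)=\int_{\mathbb{R}^d}f\,\mu(dx),$$ i.e., $\mu_t$ weakly$^*$ converges to $\mu$ as $t\to+\infty$.
   Context: Let $I$ be an open right halfline. For $t\in I$ let $(\mathcal{A}(t)\zeta)(x)=\mathrm{Tr}(Q(t)D^2\zeta(x))+\langle b(t,x),\nabla\zeta(x)\rangle$, $x\in\mathbb{R}^d$, where $Q(t)=[q_{ij}(t)]_{i,j=1,\dots,d}$ depends only on $t$, $b=(b_1,\dots,b_d)$, and the following hypotheses hold. (i) For some $\alpha\in(0,1)$, $q_{ij}\in C^{\alpha/2}_{\rm loc}(I)$ and $b_i\in C^{\alpha/2,\alpha}_{\rm loc}(I\times\mathbb{R}^d)$ (parabolic Hölder continuity on compact sets: exponent $\alpha/2$ in time and $\alpha$ in space). (ii) For every $t\in I$ the matrix $Q(t)$ is symmetric and there are constants $0<\eta_0<\Lambda$ with $\eta_0|\xi|^2\le\langle Q(t)\xi,\xi\rangle\le\Lambda|\xi|^2$ for all $(t,\xi)\in I\times\mathbb{R}^d$. (iii) There are $\varphi\in C^2(\mathbb{R}^d)$ with positive values and constants $a,c>0$ such that $\lim_{|x|\to+\infty}\varphi(x)=+\infty$ and $(\mathcal{A}(t)\varphi)(x)\le a-c\varphi(x)$ for all $(t,x)\in I\times\mathbb{R}^d$. (iv) The first order spatial derivatives of each $b_i$ exist and belong to $C^{\alpha/2,\alpha}_{\rm loc}(I\times\mathbb{R}^d)$,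 and there is $r_0<0$ such that $\langle\nabla_xb(t,x)\xi,\xi\rangle\le r_0|\xi|^2$ for all $(t,x)\in I\times\mathbb{R}^d$, $\xi\in\mathbb{R}^d$. $C_b(\mathbb{R}^d)$ is the space of bounded continuous real functions. For $f\in C_b(\mathbb{R}^d)$ and $s\in I$, $(t,x)\mapsto(G(t,s)f)(x)$ denotes the unique bounded classical solution (in $C_b([s,+\infty)\times\mathbb{R}^d)\cap C^{1,2}((s,+\infty)\times\mathbb{R}^d)$) of $D_tu=\mathcal{A}(t)u$ for $t>s$, $u(s,\cdot)=f$. An evolution system of measures for $G(t,s)$ is a family $\{\mu_t:t\in I\}$ of Borel probability measures on $\mathbb{R}^d$ with $\int_{\mathbb{R}^d}G(t,s)f\,d\mu_t=\int_{\mathbb{R}^d}f\,d\mu_s$ for all $t>s$ in $I$ and $f\in C_b(\mathbb{R}^d)$. It is tight if for every $\varepsilon>0$ there is $R>0$ with $\mu_t(\mathbb{R}^d\setminus B(0,R))\le\varepsilon$ for all $t\in I$. Under these hypotheses there is a unique tight evolution system of measures, denoted $\{\mu_t:t\in I\}$; it satisfies $\sup_{t\in I}\int\varphi\,d\mu_t<+\infty$. Assume in addition: (a) for every $r>0$ and some (hence any) $t_0\in I$, $\sup_{(t,x)\in(t_0,+\infty)\times B(0,r)}|b(t,x)|<+\infty$; (b) there is a $d\times d$ real matrix $Q=[q_{ij}]$ with $\lim_{t\to+\infty}Q(t)=Q$; (c) there are functions $b_j\in C^\alpha_{\rm loc}(\mathbb{R}^d)$ ($j=1,\dots,d$) with $\lim_{t\to+\infty}b_j(t,x)=b_j(x)$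 for all $x\in\mathbb{R}^d$. Let $\mathcal{A}\zeta(x)=\sum_{i,j=1}^dq_{ij}D_{ij}\zeta(x)+\sum_{j=1}^db_j(x)D_j\zeta(x)$ be the limit operator. It is uniformly elliptic and satisfies $\mathcal{A}\varphi\le a-c\varphi$. Let $T(t)$ be the associated Markov semigroup on $C_b(\mathbb{R}^d)$: for $f\in C_b(\mathbb{R}^d)$, $T(\cdot)f$ is the unique solution in $C_b([0,+\infty)\times\mathbb{R}^d)\cap C^{1,2}((0,+\infty)\times\mathbb{R}^d)$ of $D_tu=\mathcal{A}u$ in $(0,+\infty)\times\mathbb{R}^d$, $u(0,\cdot)=f$. Let $\mu$ be its unique invariant measure, i.e. the unique Borel probability measure with $\int_{\mathbb{R}^d}T(t)f\,d\mu=\int_{\mathbb{R}^d}f\,d\mu$ for all $t>0$, $f\in C_b(\mathbb{R}^d)$. *)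

theory Defs
  imports "HOL-Probability.Probability"
begin

section \<open>Partial derivatives and classes of differentiable functions\<close>

definition has_partial :: "'n::finite \<Rightarrow> (real^'n \<Rightarrow> real) \<Rightarrow> real^'n \<Rightarrow> bool" where
  "has_partial i f x \<longleftrightarrow> (\<lambda>h. f (x + h *\<^sub>R axis i 1)) field_differentiable (at 0)"

definition partial :: "'n::finite \<Rightarrow> (real^'n \<Rightarrow> real) \<Rightarrow> real^'n \<Rightarrow> real" where
  "partial i f x = deriv (\<lambda>h. f (x + h *\<^sub>R axis i 1)) 0"

definition grad :: "(real^'n \<Rightarrow> real) \<Rightarrow> real^'n \<Rightarrow> real^('n::finite)" where
  "grad f x = (\<chi> i. partial i f x)"

definition hessian :: "(real^'n \<Rightarrow> real) \<Rightarrow> real^'n \<Rightarrow> real^'n^('n::finite)" where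
  "hessian f x = (\<chi> i j. partial i (partial j f) x)"

definition jacobian_matrix :: "(real^'n \<Rightarrow> real^'n) \<Rightarrow> real^'n \<Rightarrow> real^'n^('n::finite)" where
  "jacobian_matrix g x = (\<chi> i j. partial j (\<lambda>y. g y $ i) x)"

definition C2 :: "(real^('n::finite) \<Rightarrow> real) \<Rightarrow> bool" where
  "C2 f \<longleftrightarrow>
     (\<forall>i x. has_partial i f x) \<and>
     (\<forall>i j x. has_partial i (partial j f) x) \<and>
     continuous_on UNIV f \<and>
     (\<forall>i. continuous_on UNIV (partial i f)) \<and>
     (\<forall>i j. continuous_on UNIV (partial i (partial j f)))"

text \<open>The class of functions that are \<open>C\<^sup>1\<close> in time and \<open>C\<^sup>2\<close> in space on
  \<open>(s, \<infinity>) \<times> \<real>\<^sup>d\<close>; all derivatives are jointly continuous in \<open>(t, x)\<close>.\<close>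

definition C12_after :: "real \<Rightarrow> (real \<Rightarrow> real^('n::finite) \<Rightarrow> real) \<Rightarrow> bool" where
  "C12_after s u \<longleftrightarrow>
     (\<forall>t>s. \<forall>x. (\<lambda>r. u r x) field_differentiable (at t)) \<and>
     (\<forall>t>s. \<forall>x i. has_partial i (u t) x) \<and>
     (\<forall>t>s. \<forall>x i j. has_partial i (partial j (u t)) x) \<and>
     continuous_on ({s<..} \<times> UNIV) (\<lambda>(t, x). u t x) \<and>
     continuous_on ({s<..} \<times> UNIV) (\<lambda>(t, x). deriv (\<lambda>r. u r x) t) \<and>
     (\<forall>i. continuous_on ({s<..} \<times> UNIV) (\<lambda>(t, x). partial i (u t) x)) \<and>
     (\<forall>i j. continuous_on ({s<..} \<times> UNIV) (\<lambda>(t, x). partial i (partial j (u t)) x))"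


section \<open>Local Hoelder continuity\<close>

definition holder_loc :: "real \<Rightarrow> 'a::metric_space set \<Rightarrow> ('a \<Rightarrow> real) \<Rightarrow> bool" where
  "holder_loc \<beta> S f \<longleftrightarrow>
     (\<forall>K. compact K \<and> K \<subseteq> S \<longrightarrow>
        (\<exists>C. \<forall>x\<in>K. \<forall>y\<in>K. \<bar>f x - f y\<bar> \<le> C * dist x y powr \<beta>))"

definition parabolic_holder_loc ::
    "real \<Rightarrow> real set \<Rightarrow> (real \<Rightarrow> real^('n::finite) \<Rightarrow> real) \<Rightarrow> bool" where
  "parabolic_holder_loc \<alpha> I f \<longleftrightarrow>
     (\<forall>K. compact K \<and> K \<subseteq> I \<times> UNIV \<longrightarrow>
        (\<exists>C. \<forall>(t, x)\<in>K. \<forall>(s, y)\<in>K.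
           \<bar>f t x - f s y\<bar> \<le> C * (\<bar>t - s\<bar> powr (\<alpha> / 2) + norm (x - y) powr \<alpha>)))"


section \<open>Kolmogorov operators, evolution operators and semigroups\<close>

definition kolmogorov_op ::
    "real^'n^'n \<Rightarrow> (real^'n \<Rightarrow> real^'n) \<Rightarrow> (real^'n \<Rightarrow> real) \<Rightarrow> real^('n::finite) \<Rightarrow> real" where
  "kolmogorov_op Q b \<zeta> x = trace (Q ** hessian \<zeta> x) + b x \<bullet> grad \<zeta> x"

text \<open>Bounded classical solutions on \<open>[s, \<infinity>) \<times> \<real>\<^sup>d\<close> of \<open>D\<^sub>t u = A(t) u\<close>, \<open>u(s, \<cdot>) = f\<close>.
  Values of \<open>u\<close> at times before \<open>s\<close> are irrelevant.\<close>

definition bounded_classical_solution ::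
    "(real \<Rightarrow> (real^'n \<Rightarrow> real) \<Rightarrow> real^'n \<Rightarrow> real) \<Rightarrow> real \<Rightarrow> (real^'n \<Rightarrow> real)
      \<Rightarrow> (real \<Rightarrow> real^('n::finite) \<Rightarrow> real) \<Rightarrow> bool" where
  "bounded_classical_solution A s f u \<longleftrightarrow>
     continuous_on ({s..} \<times> UNIV) (\<lambda>(t, x). u t x) \<and>
     bounded ((\<lambda>(t, x). u t x) ` ({s..} \<times> UNIV)) \<and>
     C12_after s u \<and>
     (\<forall>t>s. \<forall>x. deriv (\<lambda>r. u r x) t = A t (u t) x) \<and>
     u s = f"

text \<open>\<open>G t s f\<close> is \<open>G(t,s)f\<close>; only arguments with \<open>s \<in> I\<close>, \<open>t \<ge> s\<close> and
  \<open>f \<in> bcontfun\<close> (the space \<open>C\<^sub>b(\<real>\<^sup>d)\<close>) are constrained.\<close>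

definition evolution_operator ::
    "real set \<Rightarrow> (real \<Rightarrow> (real^'n \<Rightarrow> real) \<Rightarrow> real^'n \<Rightarrow> real)
      \<Rightarrow> (real \<Rightarrow> real \<Rightarrow> (real^'n \<Rightarrow> real) \<Rightarrow> real^('n::finite) \<Rightarrow> real) \<Rightarrow> bool" where
  "evolution_operator I A G \<longleftrightarrow>
     (\<forall>s\<in>I. \<forall>f\<in>bcontfun. bounded_classical_solution A s f (\<lambda>t. G t s f))"

definition markov_semigroup ::
    "((real^'n \<Rightarrow> real) \<Rightarrow> real^'n \<Rightarrow> real)
      \<Rightarrow> (real \<Rightarrow> (real^'n \<Rightarrow> real) \<Rightarrow> real^('n::finite) \<Rightarrow> real) \<Rightarrow> bool" where
  "markov_semigroup A T \<longleftrightarrow>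
     (\<forall>f\<in>bcontfun. bounded_classical_solution (\<lambda>_. A) 0 f (\<lambda>t. T t f))"


section \<open>Evolution systems of measures and invariant measures\<close>

definition borel_prob :: "'a::topological_space measure \<Rightarrow> bool" where
  "borel_prob M \<longleftrightarrow> prob_space M \<and> sets M = sets borel"

definition evolution_system_of_measures ::
    "real set \<Rightarrow> (real \<Rightarrow> real \<Rightarrow> (real^'n \<Rightarrow> real) \<Rightarrow> real^('n::finite) \<Rightarrow> real)
      \<Rightarrow> (real \<Rightarrow> (real^'n) measure) \<Rightarrow> bool" where
  "evolution_system_of_measures I G \<mu> \<longleftrightarrow>
     (\<forall>t\<in>I. borel_prob (\<mu> t)) \<and>
     (\<forall>s\<in>I. \<forall>t\<in>I. s < t \<longrightarrow>
        (\<forall>f\<in>bcontfun. (LINT x|\<mu> t. G t s f x) = (LINT x|\<mu> s. f x)))"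

definition tight_family :: "real set \<Rightarrow> (real \<Rightarrow> 'a::real_normed_vector measure) \<Rightarrow> bool" where
  "tight_family I \<mu> \<longleftrightarrow> (\<forall>\<epsilon>>0. \<exists>R>0. \<forall>t\<in>I. measure (\<mu> t) (- ball 0 R) \<le> \<epsilon>)"

definition invariant_measure ::
    "(real \<Rightarrow> (real^'n \<Rightarrow> real) \<Rightarrow> real^('n::finite) \<Rightarrow> real) \<Rightarrow> (real^'n) measure \<Rightarrow> bool" where
  "invariant_measure T m \<longleftrightarrow>
     borel_prob m \<and>
     (\<forall>t>0. \<forall>f\<in>bcontfun. (LINT x|m. T t f x) = (LINT x|m. f x))"

end

theory Submission
  imports Defs
begin

text \<open>Write \<open>u\<^sub>t(r, x) = (G(t + r, t)f)(x)\<close> and \<open>v(r, y) = (T(r)f)(y)\<close>. The invariance properties give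
\<open>\<integral> f d\<mu>\<^sub>t = \<integral> u\<^sub>t(S, \<cdot>) d\<mu>\<^sub>t\<^sub>+\<^sub>S\<close> and \<open>\<integral> f dm = \<integral> v(S, \<cdot>) dm\<close> for every \<open>S > 0\<close>. All measures involved are uniformly
tight, so it is enough that \<open>u\<^sub>t(S, x) - v(S, y)\<close> is small, for \<^emph>\<open>independent\<close> points \<open>x\<close> and \<open>y\<close> of a
fixed ball, when first \<open>S\<close> and then \<open>t\<close> is large. This contains at once the convergence of the evolution
operator to the semigroup and the loss of memory of the semigroup caused by dissipativity.

The estimate (\<open>solutions_merge_one_sided\<close>) comes from a maximum principle on \<open>\<real>\<^sup>d \<times> \<real>\<^sup>d\<close> with doubled variables
(\<open>doubling_comparison\<close>), the analytic form of a coupling of two diffusions driven by the same noise. The difference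
\<open>u\<^sub>t(r, x) - v(r, y)\<close> is compared with

\<open>\<delta> + k (exp (\<rho> r) |x - y|\<^sup>2 + \<kappa> r) + \<epsilon> (exp (- c r) (\<phi> x + \<phi> y) + 2 (a + 1) / c (1 - exp (- c r)))\<close>.

At \<open>r = 0\<close> the terms with \<open>\<delta>\<close> and \<open>k\<close> dominate the modulus of continuity of \<open>f\<close> on a compact set, outside which the
last term exceeds the oscillation of \<open>f\<close>. The quadratic term decays, since
the drift contracts distances and the noise that is common to both variables does not change \<open>x - y\<close>
(\<open>generator_difference_at_max\<close>). The term with \<open>\<epsilon>\<close> is
the supersolution built from the Lyapunov function. It confines a positive maximum of the difference to a compact
set that does not depend on \<open>t\<close>, and on this set the coefficients at large times are uniformly close to their
limits; for the drift, which converges pointwise, this rests on dissipativity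
(\<open>eventually_drift_dissipative_against_limit\<close>). The common noise has the matrix \<open>(1 - \<theta>)Q\<close>, with \<open>Q\<close> the limit
matrix: by ellipticity it lies below both \<open>Q(t)\<close> and \<open>Q\<close> for large \<open>t\<close>.\<close>

section \<open>Second-order expansions\<close>

text \<open>The increment is split into one step along each coordinate axis; the mean value theorem turns a step into a
partial derivative at a nearby point, and continuity replaces that point by \<open>x\<close>.\<close>

lemma has_derivative_if_continuous_partials:
  fixes f :: "real^'n::finite \<Rightarrow> real"
  assumes ex: "\<And>i y. has_partial i f y"
    and cont: "\<And>i. continuous_on UNIV (partial i f)"
  shows "(f has_derivative (\<lambda>h. grad f x \<bullet> h)) (at x)"
proof -
  define P :: "'n set \<Rightarrow> real^'n \<Rightarrow> real^'n" where "P S h = (\<Sum>i\<in>S. (h $ i) *\<^sub>R axis i 1)" for S h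
  have PU: "P UNIV h = h" for h
    unfolding P_def by (simp add: vec_eq_iff axis_def if_distrib cong: if_cong)
  have Pn: "norm (P S h) \<le> norm h" for S h
  proof -
    have "P S h $ i = (if i \<in> S then h $ i else 0)" for i
      unfolding P_def by (simp add: axis_def if_distrib cong: if_cong)
    then show ?thesis by (intro norm_le_componentwise_cart) auto
  qed
  \<comment> \<open>One coordinate step; \<open>t\<close> may have either sign.\<close>
  have step: "\<exists>z. norm (z - y) \<le> \<bar>t\<bar> \<and> f (y + t *\<^sub>R axis i 1) - f y = t * partial i f z" for y t i
  proof -
    define g where "g s = f (y + s *\<^sub>R axis i 1)" for s
    have dg: "(g has_real_derivative partial i f (y + s *\<^sub>R axis i 1)) (at s)" for s
    proof -
      have "((\<lambda>h. f ((y + s *\<^sub>R axis i 1) + h *\<^sub>R axis i 1)) has_real_derivative partial i f (y + s *\<^sub>R axis i 1)) (at 0)"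
        using ex[of i "y + s *\<^sub>R axis i 1"] unfolding has_partial_def partial_def
        by (simp add: DERIV_deriv_iff_field_differentiable)
      then have "((\<lambda>h. g (s + h)) has_real_derivative partial i f (y + s *\<^sub>R axis i 1)) (at 0)"
        by (simp add: g_def algebra_simps)
      then show ?thesis using DERIV_at_within_shift[of g _ s 0 UNIV] by simp
    qed
    have "\<exists>s. \<bar>s\<bar> \<le> \<bar>t\<bar> \<and> g t - g 0 = t * partial i f (y + s *\<^sub>R axis i 1)"
    proof (cases t "0::real" rule: linorder_cases)
      case less
      from MVT2[of t 0 g "\<lambda>s. partial i f (y + s *\<^sub>R axis i 1)"] less dg
      obtain s where "t < s" "s < 0" "g 0 - g t = (0 - t) * partial i f (y + s *\<^sub>R axis i 1)" by blast
      then show ?thesis by (intro exI[of _ s]) auto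
    next
      case equal then show ?thesis by (intro exI[of _ 0]) auto
    next
      case greater
      from MVT2[of 0 t g "\<lambda>s. partial i f (y + s *\<^sub>R axis i 1)"] greater dg
      obtain s where "0 < s" "s < t" "g t - g 0 = (t - 0) * partial i f (y + s *\<^sub>R axis i 1)" by blast
      then show ?thesis by (intro exI[of _ s]) auto
    qed
    then obtain s where s: "\<bar>s\<bar> \<le> \<bar>t\<bar>" "g t - g 0 = t * partial i f (y + s *\<^sub>R axis i 1)" by blast
    then show ?thesis by (intro exI[of _ "y + s *\<^sub>R axis i 1"]) (auto simp: g_def norm_axis_1)
  qed
  have main: "\<exists>d>0. \<forall>h. norm h < d \<longrightarrow>
      \<bar>f (x + P S h) - f x - (\<Sum>i\<in>S. partial i f x * h $ i)\<bar> \<le> e * real (card S) * norm h"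
    if "e > 0" for S e
  proof -
    have "finite S" by simp
    then show ?thesis
    proof (induction S)
      case empty then show ?case by (auto simp: P_def intro: exI[of _ 1])
    next
      case (insert i S)
      then obtain d where d: "d > 0" "\<And>h. norm h < d \<Longrightarrow>
        \<bar>f (x + P S h) - f x - (\<Sum>i\<in>S. partial i f x * h $ i)\<bar> \<le> e * real (card S) * norm h" by blast
      have "isCont (partial i f) x" using cont[of i] continuous_on_eq_continuous_at open_UNIV by blast
      then obtain d' where d': "d' > 0" "\<And>z. dist z x < d' \<Longrightarrow> dist (partial i f z) (partial i f x) < e"
        using \<open>e > 0\<close> unfolding continuous_at_eps_delta by blast
      have "\<bar>f (x + P (insert i S) h) - f x - (\<Sum>i\<in>insert i S. partial i f x * h $ i)\<bar> \<le> e * real (card (insert i S)) * norm h"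
        if h: "norm h < min d (d' / 2)" for h
      proof -
        have hi: "\<bar>h $ i\<bar> \<le> norm h" by (rule component_le_norm_cart)
        from step[of "x + P S h" "h $ i" i] obtain z where z:
          "norm (z - (x + P S h)) \<le> \<bar>h $ i\<bar>"
          "f ((x + P S h) + (h $ i) *\<^sub>R axis i 1) - f (x + P S h) = h $ i * partial i f z" by blast
        have "norm (z - x) \<le> norm (z - (x + P S h)) + norm (P S h)"
          using norm_triangle_ineq[of "z - (x + P S h)" "P S h"] by (simp add: algebra_simps)
        also have "\<dots> < d'" using z(1) hi Pn[of S h] h by linarith
        finally have a: "\<bar>partial i f z - partial i f x\<bar> < e" using d'(2)[of z] by (simp add: dist_norm)
        have k: "\<bar>h $ i * partial i f z - partial i f x * h $ i\<bar> \<le> e * norm h"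
        proof -
          have "\<bar>h $ i * partial i f z - partial i f x * h $ i\<bar> = \<bar>partial i f z - partial i f x\<bar> * \<bar>h $ i\<bar>"
            by (simp add: abs_mult[symmetric] algebra_simps)
          also have "\<dots> \<le> e * norm h" using a hi by (intro mult_mono) auto
          finally show ?thesis .
        qed
        have Pi: "x + P (insert i S) h = (x + P S h) + (h $ i) *\<^sub>R axis i 1"
          using insert.hyps by (simp add: P_def algebra_simps)
        have s1: "(\<Sum>j\<in>insert i S. partial j f x * h $ j) = partial i f x * h $ i + (\<Sum>j\<in>S. partial j f x * h $ j)"
          using insert.hyps by simp
        have s2: "e * real (card (insert i S)) * norm h = e * norm h + e * real (card S) * norm h"
          using insert.hyps by (simp add: algebra_simps)
        show ?thesis unfolding Pi s1 s2 using k z(2) d(2)[of h] h by linarith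
      qed
      then show ?case using d(1) d'(1) by (intro exI[of _ "min d (d' / 2)"]) auto
    qed
  qed
  show ?thesis
    unfolding has_derivative_at_alt
  proof (intro conjI allI impI)
    show "bounded_linear (\<lambda>h. grad f x \<bullet> h)" by (rule bounded_linear_inner_right)
    fix e :: real assume "0 < e"
    define n where "n = real (card (UNIV :: 'n set))"
    have n: "n > 0" unfolding n_def by (simp add: finite_UNIV_card_ge_0)
    obtain d where d: "d > 0" "\<And>h. norm h < d \<Longrightarrow>
      \<bar>f (x + P UNIV h) - f x - (\<Sum>i\<in>UNIV. partial i f x * h $ i)\<bar> \<le> e / n * n * norm h"
      using main[of "e / n" UNIV] \<open>0 < e\<close> n unfolding n_def by (auto simp: divide_pos_pos)
    show "\<exists>d>0. \<forall>y. norm (y - x) < d \<longrightarrow> norm (f y - f x - grad f x \<bullet> (y - x)) \<le> e * norm (y - x)"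
      using d(1)
    proof (intro exI[of _ d] conjI allI impI)
      fix y assume "norm (y - x) < d"
      from d(2)[OF this] n show "norm (f y - f x - grad f x \<bullet> (y - x)) \<le> e * norm (y - x)"
        by (simp add: PU grad_def inner_vec_def)
    qed
  qed
qed

lemma has_real_derivative_along_line:
  fixes q :: "real^'n::finite \<Rightarrow> real"
  assumes "\<And>i y. has_partial i q y" "\<And>i. continuous_on UNIV (partial i q)"
  shows "((\<lambda>s. q (x + s *\<^sub>R \<xi>)) has_real_derivative grad q (x + h *\<^sub>R \<xi>) \<bullet> \<xi>) (at h)"
proof -
  have "((\<lambda>s. q (x + s *\<^sub>R \<xi>)) has_derivative (\<lambda>s. grad q (x + h *\<^sub>R \<xi>) \<bullet> (s *\<^sub>R \<xi>))) (at h)"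
    by (rule has_derivative_compose[OF _ has_derivative_if_continuous_partials[OF assms]])
      (auto intro!: derivative_eq_intros)
  then show ?thesis
    by (simp add: has_field_derivative_def fun_eq_iff mult.commute[of _ "grad q (x + h *\<^sub>R \<xi>) \<bullet> \<xi>"])
qed

text \<open>Second-order expansion with Peano remainder along every line through \<open>x\<close>: exactly what a second derivative
test at a maximum consumes. Expansions of several functions can be added.\<close>

definition second_order_jet ::
  "(real^'n::finite \<Rightarrow> real) \<Rightarrow> real^'n \<Rightarrow> real^'n \<Rightarrow> real^'n^'n \<Rightarrow> bool" where
  "second_order_jet f x g H \<longleftrightarrow>
     (\<forall>\<xi>. ((\<lambda>h. (f (x + h *\<^sub>R \<xi>) - f x - h * (g \<bullet> \<xi>) - h\<^sup>2 / 2 * (\<xi> \<bullet> (H *v \<xi>))) / h\<^sup>2)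
        \<longlongrightarrow> 0) (at 0))"

lemma taylor_peano2:
  fixes p p' :: "real \<Rightarrow> real"
  assumes p: "\<And>h. (p has_real_derivative p' h) (at h)"
    and p': "(p' has_real_derivative B) (at 0)"
  shows "((\<lambda>h. (p h - p 0 - h * p' 0 - h\<^sup>2 / 2 * B) / h\<^sup>2) \<longlongrightarrow> 0) (at 0)"
proof (rule lhopital)
  let ?N = "\<lambda>h. p h - p 0 - h * p' 0 - h\<^sup>2 / 2 * B"
  show "?N \<midarrow>0\<rightarrow> 0"
    using DERIV_isCont[OF p, of 0] unfolding isCont_def
    by (auto intro!: tendsto_eq_intros)
  show "(\<lambda>h::real. h\<^sup>2) \<midarrow>0\<rightarrow> 0" by (auto intro!: tendsto_eq_intros)
  show "\<forall>\<^sub>F h in at 0. h\<^sup>2 \<noteq> (0::real)" by (auto simp: eventually_at intro: exI[of _ 1])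
  show "\<forall>\<^sub>F h in at 0. 2 * h \<noteq> (0::real)" by (auto simp: eventually_at intro: exI[of _ 1])
  show "\<forall>\<^sub>F h in at 0. (?N has_real_derivative (p' h - p' 0 - h * B)) (at h)"
    by (intro always_eventually allI) (auto intro!: derivative_eq_intros p simp: field_simps)
  show "\<forall>\<^sub>F h in at 0. ((\<lambda>h. h\<^sup>2) has_real_derivative 2 * h) (at h)"
    by (intro always_eventually allI) (auto intro!: derivative_eq_intros)
  have "((\<lambda>h. (p' h - p' 0) / h) \<longlongrightarrow> B) (at 0)"
    using p' by (simp add: DERIV_def)
  then have "((\<lambda>h. ((p' h - p' 0) / h - B) / 2) \<longlongrightarrow> (B - B) / 2) (at 0)"
    by (intro tendsto_intros) auto
  then have "((\<lambda>h. ((p' h - p' 0) / h - B) / 2) \<longlongrightarrow> 0) (at 0)" by simp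
  then show "((\<lambda>h. (p' h - p' 0 - h * B) / (2 * h)) \<longlongrightarrow> 0) (at 0)"
    by (rule Lim_transform_eventually) (auto simp: eventually_at field_simps intro!: exI[of _ 1])
qed

lemma second_order_jet_if_continuous_partials:
  fixes f :: "real^'n::finite \<Rightarrow> real"
  assumes ex1: "\<And>i y. has_partial i f y"
    and ex2: "\<And>i j y. has_partial i (partial j f) y"
    and cont1: "\<And>i. continuous_on UNIV (partial i f)"
    and cont2: "\<And>i j. continuous_on UNIV (partial i (partial j f))"
  shows "second_order_jet f x (grad f x) (hessian f x)"
  unfolding second_order_jet_def
proof
  fix \<xi> :: "real^'n"
  define p where "p h = f (x + h *\<^sub>R \<xi>)" for h
  define p' where "p' h = grad f (x + h *\<^sub>R \<xi>) \<bullet> \<xi>" for h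
  have d1: "(p has_real_derivative p' h) (at h)" for h
    unfolding p_def p'_def by (rule has_real_derivative_along_line[OF ex1 cont1])
  have "((\<lambda>h. \<Sum>j\<in>UNIV. partial j f (x + h *\<^sub>R \<xi>) * \<xi> $ j) has_real_derivative
      (\<Sum>j\<in>UNIV. (grad (partial j f) (x + 0 *\<^sub>R \<xi>) \<bullet> \<xi>) * \<xi> $ j)) (at 0)"
    by (intro DERIV_sum DERIV_cmult_right has_real_derivative_along_line ex2 cont2)
  moreover have "(\<Sum>j\<in>UNIV. (grad (partial j f) (x + 0 *\<^sub>R \<xi>) \<bullet> \<xi>) * \<xi> $ j) = \<xi> \<bullet> (hessian f x *v \<xi>)"
    unfolding grad_def hessian_def inner_vec_def matrix_vector_mult_def
    by (simp add: sum_distrib_left sum_distrib_right) (subst sum.swap, simp add: mult_ac)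
  ultimately have d2: "(p' has_real_derivative \<xi> \<bullet> (hessian f x *v \<xi>)) (at 0)"
    unfolding p'_def grad_def inner_vec_def by simp
  show "((\<lambda>h. (f (x + h *\<^sub>R \<xi>) - f x - h * (grad f x \<bullet> \<xi>) - h\<^sup>2 / 2 * (\<xi> \<bullet> (hessian f x *v \<xi>))) / h\<^sup>2)
        \<longlongrightarrow> 0) (at 0)"
    using taylor_peano2[of p p', OF d1 d2] by (simp add: p_def p'_def)
qed

text \<open>Divided by \<open>h\<close>, the expansion gives the derivative, which vanishes at a maximum; divided by \<open>h\<^sup>2\<close>, it then
exhibits \<open>B / 2\<close> as a limit of nonpositive quotients.\<close>

lemma peano_expansion_at_max:
  fixes F :: "real \<Rightarrow> real"
  assumes exp: "((\<lambda>h. (F h - F 0 - h * A - h\<^sup>2 / 2 * B) / h\<^sup>2) \<longlongrightarrow> 0) (at 0)"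
    and max: "\<And>h. F h \<le> F 0"
  shows "A = 0" "B \<le> 0"
proof -
  have "((\<lambda>h. h * ((F h - F 0 - h * A - h\<^sup>2 / 2 * B) / h\<^sup>2) + A + h / 2 * B) \<longlongrightarrow> 0 * 0 + A + 0 / 2 * B) (at 0)"
    by (intro tendsto_intros exp) simp
  then have "((\<lambda>h. (F h - F 0) / h) \<longlongrightarrow> A) (at 0)"
    by (rule Lim_transform_eventually[THEN tendsto_eq_rhs])
       (auto simp: eventually_at field_simps power2_eq_square intro!: exI[of _ 1])
  then have d: "(F has_real_derivative A) (at 0)" by (simp add: DERIV_def)
  show "A = 0" by (rule DERIV_local_max[OF d, of 1]) (auto simp: max)
  then have "((\<lambda>h. 2 * ((F h - F 0 - h\<^sup>2 / 2 * B) / h\<^sup>2) + B) \<longlongrightarrow> 2 * 0 + B) (at 0)"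
    using exp by (intro tendsto_intros) auto
  then have "((\<lambda>h. 2 * (F h - F 0) / h\<^sup>2) \<longlongrightarrow> B) (at 0)"
    by (rule Lim_transform_eventually[THEN tendsto_eq_rhs])
       (auto simp: eventually_at field_simps intro!: exI[of _ 1])
  then show "B \<le> 0"
    by (rule tendsto_upperbound) (auto simp: max divide_le_0_iff)
qed

section \<open>Traces against positive semidefinite matrices\<close>

definition psd :: "real^'n^'n::finite \<Rightarrow> bool" where
  "psd Q \<longleftrightarrow> transpose Q = Q \<and> (\<forall>\<xi>. 0 \<le> \<xi> \<bullet> (Q *v \<xi>))"

lemma trace_mult_linear:
  fixes A B C :: "real^'n^'n::finite"
  shows "trace ((A - B) ** C) = trace (A ** C) - trace (B ** C)"
    and "trace (A ** (B - C)) = trace (A ** B) - trace (A ** C)"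
    and "trace (A ** (B + C)) = trace (A ** B) + trace (A ** C)"
    and "trace (A ** (s *\<^sub>R B)) = s * trace (A ** B)"
    and "trace ((s *\<^sub>R A) ** B) = s * trace (A ** B)"
    and "trace (A ** (- B)) = - trace (A ** B)"
  by (simp_all add: trace_def matrix_matrix_mult_def sum_subtractf sum.distrib sum_distrib_left
      sum_negf algebra_simps)

text \<open>A positive semidefinite \<open>Q\<close> is a sum of matrices \<open>w w\<^sup>T\<close> with nonnegative weights, and
\<open>trace (w w\<^sup>T H) = w \<bullet> H w\<close>. The decomposition is obtained by Gaussian elimination: subtracting
\<open>\<beta>\<^sup>-\<^sup>1 w w\<^sup>T\<close>, with \<open>w\<close> the column of index \<open>i\<close> and \<open>\<beta>\<close> its diagonal entry, keeps \<open>Q\<close> positive semidefinite and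
clears row and column \<open>i\<close>. The induction is over the set of columns that may be nonzero.\<close>

lemma trace_mult_nonpos:
  fixes Q H :: "real^'n^'n::finite"
  assumes Q: "psd Q" and H: "\<And>\<xi>. \<xi> \<bullet> (H *v \<xi>) \<le> 0"
  shows "trace (Q ** H) \<le> 0"
proof -
  have "\<forall>Q. psd Q \<and> (\<forall>i. i \<notin> S \<longrightarrow> Q *v axis i 1 = 0) \<longrightarrow> trace (Q ** H) \<le> 0" for S :: "'n set"
  proof -
    have "finite S" by simp
    then show ?thesis
    proof (induction S)
      case empty
      have "trace (Q ** H) \<le> 0" if "\<forall>i. Q *v axis i 1 = 0" for Q :: "real^'n^'n"
      proof -
        have "Q = 0" using that by (simp add: matrix_vector_mult_basis column_def vec_eq_iff)
        then show ?thesis by (simp add: trace_def matrix_matrix_mult_def)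
      qed
      then show ?case by simp
    next
      case (insert i S)
      show ?case
      proof (intro allI impI)
        fix Q :: "real^'n^'n"
        assume a: "psd Q \<and> (\<forall>j. j \<notin> insert i S \<longrightarrow> Q *v axis j 1 = 0)"
        then have sym: "Q $ k $ j = Q $ j $ k" for j k
          unfolding psd_def by (metis transpose_def vec_lambda_beta)
        define w where "w = Q *v axis i 1"
        have w: "w $ j = Q $ j $ i" for j by (simp add: w_def matrix_vector_mult_basis column_def)
        define \<beta> where "\<beta> = w $ i"
        have adj: "axis i 1 \<bullet> (Q *v \<xi>) = w \<bullet> \<xi>" for \<xi>
          unfolding inner_axis' by (simp add: matrix_vector_mult_def inner_vec_def w sym[of i])
        have adj': "(Q *v \<xi>) $ i = w \<bullet> \<xi>" for \<xi> using adj[of \<xi>] by (simp add: inner_axis')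
        \<comment> \<open>Positivity on \<open>\<xi> + s e\<^sub>i\<close> as a polynomial in \<open>s\<close>: it yields that a zero diagonal entry has a zero
          column, and with \<open>s = - (w \<bullet> \<xi>) / \<beta>\<close> that the reduced matrix is positive semidefinite.\<close>
        have quad: "0 \<le> \<xi> \<bullet> (Q *v \<xi>) + 2 * s * (w \<bullet> \<xi>) + s\<^sup>2 * \<beta>" for \<xi> s
        proof -
          have "0 \<le> (\<xi> + s *\<^sub>R axis i 1) \<bullet> (Q *v (\<xi> + s *\<^sub>R axis i 1))" using a psd_def by blast
          also have "\<dots> = \<xi> \<bullet> (Q *v \<xi>) + 2 * s * (w \<bullet> \<xi>) + s\<^sup>2 * \<beta>"
            by (simp add: algebra_simps matrix_vector_right_distrib inner_add_left inner_add_right adj'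
                w_def[symmetric] \<beta>_def inner_axis inner_axis' power2_eq_square inner_commute)
          finally show ?thesis .
        qed
        show "trace (Q ** H) \<le> 0"
        proof (cases "w = 0")
          case True
          then have "\<forall>j. j \<notin> S \<longrightarrow> Q *v axis j 1 = 0" using a w_def by auto
          then show ?thesis using insert.IH a by blast
        next
          case False
          have "\<beta> \<ge> 0" using quad[of 0 1] by simp
          moreover have "\<beta> \<noteq> 0"
          proof
            assume z: "\<beta> = 0"
            define s where "s = - (w \<bullet> (Q *v w) + 1) / (2 * (w \<bullet> w))"
            have "2 * s * (w \<bullet> w) = - (w \<bullet> (Q *v w) + 1)" using False by (simp add: s_def)
            moreover have "0 \<le> w \<bullet> (Q *v w) + 2 * s * (w \<bullet> w)" using quad[of w s] z by simp
            ultimately show False by linarith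
          qed
          ultimately have \<beta>: "\<beta> > 0" by simp
          define W :: "real^'n^'n" where "W = (\<chi> k j. w $ k * w $ j)"
          define Q' where "Q' = Q - (1/\<beta>) *\<^sub>R W"
          have W: "W *v \<xi> = (w \<bullet> \<xi>) *\<^sub>R w" for \<xi>
            by (simp add: W_def vec_eq_iff matrix_vector_mult_def inner_vec_def sum_distrib_left mult_ac)
          have Q': "Q' *v \<xi> = Q *v \<xi> - ((w \<bullet> \<xi>) / \<beta>) *\<^sub>R w" for \<xi>
            by (simp add: Q'_def matrix_vector_mult_diff_rdistrib scaleR_matrix_vector_assoc[symmetric] W)
          have "psd Q'"
            unfolding psd_def
          proof (intro conjI allI)
            show "transpose Q' = Q'"
              by (simp add: Q'_def W_def transpose_def vec_eq_iff sym mult.commute)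
            fix \<xi>
            have "\<xi> \<bullet> (Q' *v \<xi>) = \<xi> \<bullet> (Q *v \<xi>) - (w \<bullet> \<xi>)\<^sup>2 / \<beta>"
              by (simp add: Q' inner_diff_right power2_eq_square inner_commute)
            moreover have "2 * (- (w \<bullet> \<xi>) / \<beta>) * (w \<bullet> \<xi>) + (- (w \<bullet> \<xi>) / \<beta>)\<^sup>2 * \<beta> = - ((w \<bullet> \<xi>)\<^sup>2 / \<beta>)"
              using \<beta> by (simp add: power2_eq_square field_simps)
            ultimately show "0 \<le> \<xi> \<bullet> (Q' *v \<xi>)"
              using quad[of \<xi> "- (w \<bullet> \<xi>) / \<beta>"] by linarith
          qed
          moreover have "Q' *v axis j 1 = 0" if "j \<notin> S" for j
          proof (cases "j = i")
            case True
            then show ?thesis using \<beta> by (simp add: Q' w_def[symmetric] \<beta>_def inner_axis)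
          next
            case False
            then have z: "Q *v axis j 1 = 0" using a that by auto
            have "w $ j = (Q *v axis j 1) $ i" by (simp add: w sym[of j] matrix_vector_mult_basis column_def)
            then show ?thesis using z by (simp add: Q' inner_axis)
          qed
          ultimately have "trace (Q' ** H) \<le> 0" using insert.IH by blast
          moreover have tW: "trace (W ** H) = w \<bullet> (H *v w)"
            unfolding trace_def matrix_matrix_mult_def W_def inner_vec_def matrix_vector_mult_def
            by (simp add: sum_distrib_left) (subst sum.swap, simp add: mult_ac)
          moreover have "trace (Q' ** H) = trace (Q ** H) - (1/\<beta>) * (w \<bullet> (H *v w))"
            unfolding tW[symmetric] by (simp add: Q'_def trace_mult_linear)
          moreover have "(1/\<beta>) * (w \<bullet> (H *v w)) \<le> 0" using H[of w] \<beta>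
            by (intro mult_nonneg_nonpos) auto
          ultimately show ?thesis by linarith
        qed
      qed
    qed
  qed
  from this[of UNIV] Q show ?thesis by simp
qed

lemma norm_matrix_vector_mult_le:
  fixes A :: "real^'n^'m::finite"
  shows "norm (A *v x) \<le> norm A * norm x"
proof -
  have "norm (A *v x) = L2_set (\<lambda>i. norm ((A *v x) $ i)) UNIV" by (rule norm_vec_def)
  also have "\<dots> \<le> L2_set (\<lambda>i. norm (A $ i) * norm x) UNIV"
    by (rule L2_set_mono) (simp_all add: matrix_vector_mul_component Cauchy_Schwarz_ineq2)
  also have "\<dots> = norm A * norm x"
    by (simp add: norm_vec_def[of A] L2_set_right_distrib[symmetric] mult.commute[of _ "norm x"])
  finally show ?thesis .
qed

text \<open>The margin \<open>\<theta> Q'\<close> is at least \<open>\<theta> \<eta>\<close> times the identity and absorbs the error \<open>Q t - Q'\<close>. This makes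
\<open>(1 - \<theta>) Q'\<close> a common part of \<open>Q t\<close> and \<open>Q'\<close>.\<close>

lemma eventually_psd_minus_shrunk_limit:
  fixes Q :: "real \<Rightarrow> real^'n^'n::finite"
  assumes lim: "(Q \<longlongrightarrow> Q') F" and sym: "\<forall>\<^sub>F t in F. transpose (Q t) = Q t"
    and sym': "transpose Q' = Q'"
    and ell: "\<And>\<xi>. \<eta> * (norm \<xi>)\<^sup>2 \<le> \<xi> \<bullet> (Q' *v \<xi>)" and pos: "0 < \<eta>" "0 < \<theta>"
  shows "\<forall>\<^sub>F t in F. psd (Q t - (1 - \<theta>) *\<^sub>R Q')"
proof -
  have "\<forall>\<^sub>F t in F. dist (Q t) Q' < \<theta> * \<eta>" using tendstoD[OF lim, of "\<theta> * \<eta>"] pos by simp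
  with sym show ?thesis
  proof eventually_elim
    case (elim t)
    show ?case unfolding psd_def
    proof (intro conjI allI)
      show "transpose (Q t - (1 - \<theta>) *\<^sub>R Q') = Q t - (1 - \<theta>) *\<^sub>R Q'"
        using elim(1) sym' by (simp add: transpose_def vec_eq_iff)
      fix \<xi>
      have "\<bar>\<xi> \<bullet> ((Q t - Q') *v \<xi>)\<bar> \<le> norm \<xi> * (norm (Q t - Q') * norm \<xi>)"
        by (rule order_trans[OF Cauchy_Schwarz_ineq2]) (intro mult_left_mono norm_matrix_vector_mult_le norm_ge_zero)
      also have "\<dots> = norm (Q t - Q') * (norm \<xi>)\<^sup>2" by (simp add: power2_eq_square)
      also have "\<dots> \<le> (\<theta> * \<eta>) * (norm \<xi>)\<^sup>2" using elim(2) by (intro mult_right_mono) (auto simp: dist_norm)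
      also have "\<dots> \<le> \<theta> * (\<xi> \<bullet> (Q' *v \<xi>))" using ell[of \<xi>] pos by simp
      finally have "\<bar>\<xi> \<bullet> ((Q t - Q') *v \<xi>)\<bar> \<le> \<theta> * (\<xi> \<bullet> (Q' *v \<xi>))" .
      then show "0 \<le> \<xi> \<bullet> ((Q t - (1 - \<theta>) *\<^sub>R Q') *v \<xi>)"
        by (simp add: matrix_vector_mult_diff_rdistrib scaleR_matrix_vector_assoc[symmetric] inner_diff_right algebra_simps)
    qed
  qed
qed

lemma tendsto_trace:
  fixes Q :: "'a \<Rightarrow> real^'n^'n::finite"
  assumes "(Q \<longlongrightarrow> Q') F"
  shows "((\<lambda>t. trace (Q t ** H)) \<longlongrightarrow> trace (Q' ** H)) F" "((\<lambda>t. trace (Q t)) \<longlongrightarrow> trace Q') F"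
  unfolding trace_def matrix_matrix_mult_def by (simp_all, (intro tendsto_intros assms)+)

section \<open>The maximum principle with doubled variables\<close>

text \<open>The heart of the coupling argument. At the maximum the test in the directions \<open>(\<xi>, \<xi>)\<close> bounds \<open>Hu - Hv\<close>
with no contribution from \<open>|x - y|\<^sup>2\<close>, which is constant along them; this is paired with the common part
\<open>Q\<^sub>0\<close>. The directions \<open>(\<xi>, 0)\<close> and \<open>(0, \<xi>)\<close> bound \<open>Hu\<close> and \<open>-Hv\<close> separately at the price of \<open>2K\<close>; they are
paired with the remainders \<open>Q\<^sub>1 - Q\<^sub>0\<close> and \<open>Q\<^sub>2 - Q\<^sub>0\<close>.\<close>

lemma generator_difference_at_max:
  fixes x y :: "real^'n::finite"
  assumes u: "second_order_jet u x gu Hu" and v: "second_order_jet v y gv Hv"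
    and p1: "second_order_jet \<phi> x g1 H1" and p2: "second_order_jet \<phi> y g2 H2"
    and max: "\<And>x' y'. u x' - v y' - (K * (norm (x' - y'))\<^sup>2 + e * (\<phi> x' + \<phi> y'))
        \<le> u x - v y - (K * (norm (x - y))\<^sup>2 + e * (\<phi> x + \<phi> y))"
    and psd: "psd Q\<^sub>0" "psd (Q\<^sub>1 - Q\<^sub>0)" "psd (Q\<^sub>2 - Q\<^sub>0)"
  shows "(trace (Q\<^sub>1 ** Hu) + \<beta>\<^sub>1 \<bullet> gu) - (trace (Q\<^sub>2 ** Hv) + \<beta>\<^sub>2 \<bullet> gv)
    \<le> e * ((trace (Q\<^sub>1 ** H1) + \<beta>\<^sub>1 \<bullet> g1) + (trace (Q\<^sub>2 ** H2) + \<beta>\<^sub>2 \<bullet> g2))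
      + K * (2 * trace (Q\<^sub>1 - Q\<^sub>0) + 2 * trace (Q\<^sub>2 - Q\<^sub>0) + 2 * ((\<beta>\<^sub>1 - \<beta>\<^sub>2) \<bullet> (x - y)))"
proof -
  have test: "gu \<bullet> \<xi> - gv \<bullet> \<zeta> - 2 * K * ((x - y) \<bullet> (\<xi> - \<zeta>)) - e * (g1 \<bullet> \<xi> + g2 \<bullet> \<zeta>) = 0"
    "\<xi> \<bullet> (Hu *v \<xi>) - \<zeta> \<bullet> (Hv *v \<zeta>) - 2 * K * (norm (\<xi> - \<zeta>))\<^sup>2 - e * (\<xi> \<bullet> (H1 *v \<xi>) + \<zeta> \<bullet> (H2 *v \<zeta>)) \<le> 0"
    for \<xi> \<zeta>
  proof -
    define J where "J f g (H :: real^'n^'n) z \<theta> h = (f (z + h *\<^sub>R \<theta>) - f z - h * (g \<bullet> \<theta>) - h\<^sup>2 / 2 * (\<theta> \<bullet> (H *v \<theta>))) / h\<^sup>2"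
      for f :: "real^'n \<Rightarrow> real" and g H z \<theta> h
    have J: "(J f g H z \<theta> \<longlongrightarrow> 0) (at 0)" if "second_order_jet f z g H" for f g H z \<theta>
      using that unfolding second_order_jet_def J_def by blast
    define F where "F h = u (x + h *\<^sub>R \<xi>) - v (y + h *\<^sub>R \<zeta>)
      - (K * (norm ((x + h *\<^sub>R \<xi>) - (y + h *\<^sub>R \<zeta>)))\<^sup>2 + e * (\<phi> (x + h *\<^sub>R \<xi>) + \<phi> (y + h *\<^sub>R \<zeta>)))" for h
    define A where "A = gu \<bullet> \<xi> - gv \<bullet> \<zeta> - 2 * K * ((x - y) \<bullet> (\<xi> - \<zeta>)) - e * (g1 \<bullet> \<xi> + g2 \<bullet> \<zeta>)"
    define B where "B = \<xi> \<bullet> (Hu *v \<xi>) - \<zeta> \<bullet> (Hv *v \<zeta>) - 2 * K * (norm (\<xi> - \<zeta>))\<^sup>2 - e * (\<xi> \<bullet> (H1 *v \<xi>) + \<zeta> \<bullet> (H2 *v \<zeta>))"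
    have sq: "(norm ((x + h *\<^sub>R \<xi>) - (y + h *\<^sub>R \<zeta>)))\<^sup>2
       = (norm (x - y))\<^sup>2 + 2 * h * ((x - y) \<bullet> (\<xi> - \<zeta>)) + h\<^sup>2 * (norm (\<xi> - \<zeta>))\<^sup>2" for h
    proof -
      have "(x + h *\<^sub>R \<xi>) - (y + h *\<^sub>R \<zeta>) = (x - y) + h *\<^sub>R (\<xi> - \<zeta>)" by (simp add: algebra_simps)
      then show ?thesis
        by (simp only: power2_norm_eq_inner inner_add_left inner_add_right inner_scaleR_left inner_scaleR_right)
          (simp add: inner_commute power2_eq_square algebra_simps)
    qed
    have "((\<lambda>h. J u gu Hu x \<xi> h - J v gv Hv y \<zeta> h - e * (J \<phi> g1 H1 x \<xi> h + J \<phi> g2 H2 y \<zeta> h)) \<longlongrightarrow> 0 - 0 - e * (0 + 0)) (at 0)"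
      by (intro tendsto_intros J u v p1 p2)
    moreover have "J u gu Hu x \<xi> h - J v gv Hv y \<zeta> h - e * (J \<phi> g1 H1 x \<xi> h + J \<phi> g2 H2 y \<zeta> h)
        = (F h - F 0 - h * A - h\<^sup>2 / 2 * B) / h\<^sup>2" for h
    proof -
      have quot: "p / d - q / d - e * (r / d + s / d) = (p - q - e * (r + s)) / d" for p q r s d :: real
        by (simp add: diff_divide_distrib add_divide_distrib distrib_left)
      show ?thesis
        unfolding J_def F_def A_def B_def sq quot
        by (rule arg_cong[where f="\<lambda>z. z / h\<^sup>2"]) (simp add: field_simps)
    qed
    ultimately have ex: "((\<lambda>h. (F h - F 0 - h * A - h\<^sup>2 / 2 * B) / h\<^sup>2) \<longlongrightarrow> 0) (at 0)" by simp
    have "F h \<le> F 0" for h using max[of "x + h *\<^sub>R \<xi>" "y + h *\<^sub>R \<zeta>"] by (simp add: F_def)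
    from peano_expansion_at_max[OF ex this] show "gu \<bullet> \<xi> - gv \<bullet> \<zeta> - 2 * K * ((x - y) \<bullet> (\<xi> - \<zeta>)) - e * (g1 \<bullet> \<xi> + g2 \<bullet> \<zeta>) = 0"
    "\<xi> \<bullet> (Hu *v \<xi>) - \<zeta> \<bullet> (Hv *v \<zeta>) - 2 * K * (norm (\<xi> - \<zeta>))\<^sup>2 - e * (\<xi> \<bullet> (H1 *v \<xi>) + \<zeta> \<bullet> (H2 *v \<zeta>)) \<le> 0"
      unfolding A_def B_def by auto
  qed
  have gu: "gu = (2 * K) *\<^sub>R (x - y) + e *\<^sub>R g1"
    by (rule vector_eq_ldot[THEN iffD1]) (use test(1)[of _ 0] in \<open>auto simp: inner_simps inner_commute algebra_simps\<close>)
  have gv: "gv = (2 * K) *\<^sub>R (x - y) - e *\<^sub>R g2"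
    by (rule vector_eq_ldot[THEN iffD1]) (use test(1)[of 0] in \<open>auto simp: inner_simps inner_commute algebra_simps\<close>)
  have t1: "trace ((Q\<^sub>1 - Q\<^sub>0) ** (Hu - e *\<^sub>R H1 - (2 * K) *\<^sub>R mat 1)) \<le> 0"
    by (rule trace_mult_nonpos[OF psd(2)]) (use test(2)[of _ 0] in
      \<open>simp add: matrix_vector_mult_diff_rdistrib scaleR_matrix_vector_assoc[symmetric] inner_diff_right power2_norm_eq_inner algebra_simps\<close>)
  have t2: "trace ((Q\<^sub>2 - Q\<^sub>0) ** (- Hv - e *\<^sub>R H2 - (2 * K) *\<^sub>R mat 1)) \<le> 0"
  proof (rule trace_mult_nonpos[OF psd(3)])
    fix \<xi>
    have "(- Hv) *v \<xi> = - (Hv *v \<xi>)" using matrix_vector_mult_diff_rdistrib[of 0 Hv \<xi>] by simp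
    then show "\<xi> \<bullet> ((- Hv - e *\<^sub>R H2 - (2 * K) *\<^sub>R mat 1) *v \<xi>) \<le> 0"
      using test(2)[of 0 \<xi>] by (simp add: matrix_vector_mult_diff_rdistrib scaleR_matrix_vector_assoc[symmetric] inner_diff_right power2_norm_eq_inner algebra_simps)
  qed
  have t0: "trace (Q\<^sub>0 ** (Hu - Hv - e *\<^sub>R (H1 + H2))) \<le> 0"
  proof (rule trace_mult_nonpos[OF psd(1)])
    fix \<xi>
    show "\<xi> \<bullet> ((Hu - Hv - e *\<^sub>R (H1 + H2)) *v \<xi>) \<le> 0"
      using test(2)[of \<xi> \<xi>]
      by (simp add: matrix_vector_mult_diff_rdistrib matrix_vector_mult_add_rdistrib
          scaleR_matrix_vector_assoc[symmetric] inner_diff_right inner_add_right algebra_simps)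
  qed
  have "\<beta>\<^sub>1 \<bullet> gu - \<beta>\<^sub>2 \<bullet> gv = e * (\<beta>\<^sub>1 \<bullet> g1 + \<beta>\<^sub>2 \<bullet> g2) + K * (2 * ((\<beta>\<^sub>1 - \<beta>\<^sub>2) \<bullet> (x - y)))"
    unfolding gu gv by (simp add: inner_simps algebra_simps)
  with t0 t1 t2 show ?thesis by (simp add: trace_mult_linear trace_sub algebra_simps)
qed

text \<open>A solution on \<open>[0, S]\<close> of the equation with coefficients \<open>Q\<close> and \<open>b\<close>, in the form in which a maximum
principle uses it. Gradient and Hessian enter through any second-order expansion, so that the class is visibly closed
under negation and contains the constants.\<close>

definition classical_solution_on ::
  "real \<Rightarrow> (real \<Rightarrow> real^'n^'n) \<Rightarrow> (real \<Rightarrow> real^'n \<Rightarrow> real^'n) \<Rightarrow> (real \<Rightarrow> real^'n::finite \<Rightarrow> real) \<Rightarrow> bool" where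
  "classical_solution_on S Q b u \<longleftrightarrow>
     continuous_on ({0..S} \<times> UNIV) (\<lambda>(r, x). u r x) \<and>
     (\<forall>r\<in>{0<..S}. \<forall>x. \<exists>g H. second_order_jet (u r) x g H \<and>
        ((\<lambda>r. u r x) has_real_derivative trace (Q r ** H) + b r x \<bullet> g) (at r))"

lemma compact_sublevel:
  fixes \<phi> :: "'a::{heine_borel, real_normed_vector} \<Rightarrow> real"
  assumes "continuous_on UNIV \<phi>" "filterlim \<phi> at_top at_infinity"
  shows "compact {x. \<phi> x \<le> L}"
proof -
  have "closed {x. \<phi> x \<le> L}" using assms(1) by (intro closed_Collect_le) auto
  moreover have "bounded {x. \<phi> x \<le> L}"
  proof -
    have "eventually (\<lambda>x. L < \<phi> x) at_infinity" using assms(2) by (simp add: filterlim_at_top_dense)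
    then show ?thesis unfolding eventually_at_infinity bounded_iff by (metis (mono_tags, lifting) linorder_not_less mem_Collect_eq nle_le)
  qed
  ultimately show ?thesis by (simp add: compact_eq_bounded_closed)
qed

text \<open>The right-hand side is a strict supersolution of the doubled equation wherever the difference exceeds it.
There the bound \<open>B\<close> on the difference forces \<open>\<epsilon> e\<^sup>-\<^sup>c\<^sup>S (\<phi> x + \<phi> y) \<le> B\<close>, so the smallness of the coefficients,
hypothesis \<open>coupling\<close>, is required on this compact region only. Growth of \<open>\<phi>\<close> makes a positive
supremum of the difference a maximum. Strictness comes from \<open>a + 1\<close> in place of \<open>a\<close>.\<close>

lemma doubling_comparison:
  fixes u v :: "real \<Rightarrow> real^'n::finite \<Rightarrow> real"
  assumes u: "classical_solution_on S Q\<^sub>1 b\<^sub>1 u" and v: "classical_solution_on S Q\<^sub>2 b\<^sub>2 v"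
    and phi: "continuous_on UNIV \<phi>" "filterlim \<phi> at_top at_infinity" "\<And>x. 0 \<le> \<phi> x"
    and jet: "\<And>x. second_order_jet \<phi> x (g x) (H x)"
    and lyap1: "\<And>r x. r \<in> {0<..S} \<Longrightarrow> trace (Q\<^sub>1 r ** H x) + b\<^sub>1 r x \<bullet> g x \<le> a - c * \<phi> x"
    and lyap2: "\<And>r x. r \<in> {0<..S} \<Longrightarrow> trace (Q\<^sub>2 r ** H x) + b\<^sub>2 r x \<bullet> g x \<le> a - c * \<phi> x"
    and ac: "0 < c" "0 \<le> a"
    and psd: "psd Q\<^sub>0" "\<And>r. r \<in> {0<..S} \<Longrightarrow> psd (Q\<^sub>1 r - Q\<^sub>0)" "\<And>r. r \<in> {0<..S} \<Longrightarrow> psd (Q\<^sub>2 r - Q\<^sub>0)"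
    and bound: "\<And>r x y. r \<in> {0..S} \<Longrightarrow> u r x - v r y \<le> B"
    and params: "0 < \<epsilon>" "0 \<le> k" "0 \<le> \<delta>" "0 \<le> \<kappa>" "\<rho> \<le> 0"
    and init: "\<And>x y. u 0 x - v 0 y \<le> \<delta> + k * (norm (x - y))\<^sup>2 + \<epsilon> * (\<phi> x + \<phi> y)"
    and coupling: "\<And>r x y. r \<in> {0<..S} \<Longrightarrow> \<epsilon> * exp (- c * S) * (\<phi> x + \<phi> y) \<le> B \<Longrightarrow>
      k * (2 * trace (Q\<^sub>1 r - Q\<^sub>0) + 2 * trace (Q\<^sub>2 r - Q\<^sub>0) + 2 * ((b\<^sub>1 r x - b\<^sub>2 r y) \<bullet> (x - y)))
        \<le> k * (\<rho> * (norm (x - y))\<^sup>2 + \<kappa>)"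
    and r: "r \<in> {0..S}"
  shows "u r x - v r y \<le> \<delta> + k * (exp (\<rho> * r) * (norm (x - y))\<^sup>2 + \<kappa> * r)
    + \<epsilon> * (exp (- c * r) * (\<phi> x + \<phi> y) + 2 * (a + 1) / c * (1 - exp (- c * r)))"
proof (rule ccontr)
  define \<Psi> where "\<Psi> r x y = \<delta> + k * (exp (\<rho> * r) * (norm (x - y))\<^sup>2 + \<kappa> * r)
    + \<epsilon> * (exp (- c * r) * (\<phi> x + \<phi> y) + 2 * (a + 1) / c * (1 - exp (- c * r)))" for r and x y :: "real^'n"
  define F where "F r x y = u r x - v r y - \<Psi> r x y" for r x y
  assume "\<not> ?thesis"
  then have Fpos: "F r x y > 0" by (simp add: F_def \<Psi>_def)
  have region: "\<epsilon> * exp (- c * S) * (\<phi> x + \<phi> y) \<le> B" if "F r x y > 0" "r \<in> {0..S}" for r x y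
  proof -
    have "exp (- c * S) \<le> exp (- c * r)" "exp (- c * r) \<le> 1" using that(2) ac by auto
    then have "exp (- c * S) * (\<phi> x + \<phi> y) \<le> exp (- c * r) * (\<phi> x + \<phi> y) + 2 * (a + 1) / c * (1 - exp (- c * r))"
      using ac phi(3)[of x] phi(3)[of y] by (intro add_increasing2 mult_right_mono) auto
    then have "\<epsilon> * (exp (- c * S) * (\<phi> x + \<phi> y)) \<le> \<epsilon> * (exp (- c * r) * (\<phi> x + \<phi> y) + 2 * (a + 1) / c * (1 - exp (- c * r)))"
      using params by (intro mult_left_mono) auto
    moreover have "0 \<le> k * (exp (\<rho> * r) * (norm (x - y))\<^sup>2 + \<kappa> * r)"
      using params that by (intro mult_nonneg_nonneg add_nonneg_nonneg) auto
    ultimately show ?thesis using that bound[OF that(2), of x y] params unfolding F_def \<Psi>_def mult.assoc by linarith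
  qed
  define L where "L = B / (\<epsilon> * exp (- c * S))"
  define K where "K = {x. \<phi> x \<le> L}"
  have inK: "x \<in> K \<and> y \<in> K" if "F r x y > 0" "r \<in> {0..S}" for r x y
  proof -
    have "\<phi> x + \<phi> y \<le> L"
      using region[OF that] params by (simp add: L_def field_simps)
    then show ?thesis using phi(3)[of x] phi(3)[of y] unfolding K_def by auto
  qed
  have contF: "continuous_on ({0..S} \<times> UNIV) (\<lambda>(r, x, y). F r x y)"
  proof -
    have u': "continuous_on ({0..S} \<times> UNIV) (\<lambda>p. u (fst p) (fst (snd p)))"
      using continuous_on_compose2[of "{0..S} \<times> UNIV" "\<lambda>(r, x). u r x" "{0..S} \<times> UNIV" "\<lambda>p. (fst p, fst (snd p))"] u
      unfolding classical_solution_on_def by (force intro!: continuous_intros)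
    have v': "continuous_on ({0..S} \<times> UNIV) (\<lambda>p. v (fst p) (snd (snd p)))"
      using continuous_on_compose2[of "{0..S} \<times> UNIV" "\<lambda>(r, x). v r x" "{0..S} \<times> UNIV" "\<lambda>p. (fst p, snd (snd p))"] v
      unfolding classical_solution_on_def by (force intro!: continuous_intros)
    have p1: "continuous_on ({0..S} \<times> UNIV) (\<lambda>p. \<phi> (fst (snd p)))" for S
      by (rule continuous_on_compose2[OF phi(1)]) (auto intro!: continuous_intros)
    have p2: "continuous_on ({0..S} \<times> UNIV) (\<lambda>p. \<phi> (snd (snd p)))" for S
      by (rule continuous_on_compose2[OF phi(1)]) (auto intro!: continuous_intros)
    show ?thesis unfolding F_def \<Psi>_def case_prod_beta
      by (intro continuous_intros u' v' p1 p2)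
  qed
  have cpt: "compact ({0..S} \<times> K \<times> K)"
    unfolding K_def by (intro compact_Times compact_Icc compact_sublevel phi)
  have "\<exists>p\<in>{0..S} \<times> K \<times> K. \<forall>q\<in>{0..S} \<times> K \<times> K. (\<lambda>(r, x, y). F r x y) q \<le> (\<lambda>(r, x, y). F r x y) p"
    using inK[OF Fpos r] r
    by (intro continuous_attains_sup cpt continuous_on_subset[OF contF]) auto
  then obtain r0 x0 y0 where m0: "r0 \<in> {0..S}" "x0 \<in> K" "y0 \<in> K"
    and m1: "\<And>r x y. r \<in> {0..S} \<Longrightarrow> x \<in> K \<Longrightarrow> y \<in> K \<Longrightarrow> F r x y \<le> F r0 x0 y0"
    by force
  have pos0: "F r0 x0 y0 > 0" using m1[OF r] inK[OF Fpos r] Fpos by force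
  have max: "F r x y \<le> F r0 x0 y0" if "r \<in> {0..S}" for r x y
    using m1[OF that, of x y] inK[OF _ that, of x y] pos0 by (cases "F r x y > 0") auto
  \<comment> \<open>The maximum is global on \<open>[0, S] \<times> \<real>\<^sup>d \<times> \<real>\<^sup>d\<close>, and by the initial condition it lies at a positive time.\<close>
  have "r0 \<noteq> 0"
    using init[of x0 y0] pos0 by (auto simp: F_def \<Psi>_def)
  then have r0: "r0 \<in> {0<..S}" using m0 by auto
  obtain gu Hu where ju: "second_order_jet (u r0) x0 gu Hu"
    "((\<lambda>r. u r x0) has_real_derivative trace (Q\<^sub>1 r0 ** Hu) + b\<^sub>1 r0 x0 \<bullet> gu) (at r0)"
    using u r0 unfolding classical_solution_on_def by blast
  obtain gv Hv where jv: "second_order_jet (v r0) y0 gv Hv"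
    "((\<lambda>r. v r y0) has_real_derivative trace (Q\<^sub>2 r0 ** Hv) + b\<^sub>2 r0 y0 \<bullet> gv) (at r0)"
    using v r0 unfolding classical_solution_on_def by blast
  define e where "e = \<epsilon> * exp (- c * r0)"
  define k' where "k' = k * exp (\<rho> * r0)"
  define D where "D = (norm (x0 - y0))\<^sup>2"
  define Lu where "Lu = trace (Q\<^sub>1 r0 ** Hu) + b\<^sub>1 r0 x0 \<bullet> gu"
  define Lv where "Lv = trace (Q\<^sub>2 r0 ** Hv) + b\<^sub>2 r0 y0 \<bullet> gv"
  define X where "X = 2 * trace (Q\<^sub>1 r0 - Q\<^sub>0) + 2 * trace (Q\<^sub>2 r0 - Q\<^sub>0) + 2 * ((b\<^sub>1 r0 x0 - b\<^sub>2 r0 y0) \<bullet> (x0 - y0))"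
  have space: "Lu - Lv \<le> e * ((trace (Q\<^sub>1 r0 ** H x0) + b\<^sub>1 r0 x0 \<bullet> g x0) + (trace (Q\<^sub>2 r0 ** H y0) + b\<^sub>2 r0 y0 \<bullet> g y0)) + k' * X"
    unfolding Lu_def Lv_def X_def
  proof (rule generator_difference_at_max[OF ju(1) jv(1) jet jet _ psd(1) psd(2)[OF r0] psd(3)[OF r0]])
    fix x' y'
    show "u r0 x' - v r0 y' - (k' * (norm (x' - y'))\<^sup>2 + e * (\<phi> x' + \<phi> y'))
      \<le> u r0 x0 - v r0 y0 - (k' * (norm (x0 - y0))\<^sup>2 + e * (\<phi> x0 + \<phi> y0))"
      using max[OF m0(1), of x' y'] unfolding F_def \<Psi>_def k'_def e_def by (simp add: algebra_simps)
  qed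
  have "k * X \<le> k * (\<rho> * D + \<kappa>)" unfolding X_def D_def using coupling[OF r0 region[OF pos0 m0(1)]] .
  then have "exp (\<rho> * r0) * (k * X) \<le> exp (\<rho> * r0) * (k * (\<rho> * D + \<kappa>))" by (rule mult_left_mono) simp
  also have "\<dots> = \<rho> * (k' * D) + exp (\<rho> * r0) * (k * \<kappa>)" by (simp add: k'_def algebra_simps)
  also have "\<dots> \<le> \<rho> * (k' * D) + 1 * (k * \<kappa>)"
    using params r0 by (intro add_left_mono mult_right_mono) (auto simp: mult_nonpos_nonneg)
  finally have X: "k' * X \<le> \<rho> * (k' * D) + k * \<kappa>" by (simp add: k'_def mult_ac)
  have e: "e > 0" using params by (simp add: e_def)
  have "e * ((trace (Q\<^sub>1 r0 ** H x0) + b\<^sub>1 r0 x0 \<bullet> g x0) + (trace (Q\<^sub>2 r0 ** H y0) + b\<^sub>2 r0 y0 \<bullet> g y0))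
    \<le> e * ((a - c * \<phi> x0) + (a - c * \<phi> y0))"
    using e lyap1[OF r0, of x0] lyap2[OF r0, of y0] by (intro mult_left_mono add_mono) auto
  with space X have upper: "Lu - Lv \<le> e * (2 * a - c * (\<phi> x0 + \<phi> y0)) + \<rho> * (k' * D) + k * \<kappa>"
    by (simp add: algebra_simps)
  have "((\<lambda>r. F r x0 y0) has_real_derivative
     (Lu - Lv) - (\<rho> * (k' * D) + k * \<kappa> + e * (2 * (a + 1) - c * (\<phi> x0 + \<phi> y0)))) (at r0)"
    unfolding F_def \<Psi>_def
    by (rule derivative_eq_intros ju(2) jv(2) refl)+
       (use ac in \<open>simp add: Lu_def Lv_def k'_def D_def e_def field_simps\<close>)
  moreover have "(Lu - Lv) - (\<rho> * (k' * D) + k * \<kappa> + e * (2 * (a + 1) - c * (\<phi> x0 + \<phi> y0))) < 0"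
    using upper e by (simp add: algebra_simps)
  \<comment> \<open>A negative time derivative gives larger values at earlier times; this covers \<open>r0 = S\<close> as well.\<close>
  ultimately obtain d where d: "d > 0" "\<And>h. 0 < h \<Longrightarrow> h < d \<Longrightarrow> F r0 x0 y0 < F (r0 - h) x0 y0"
    using DERIV_neg_dec_left by blast
  define h where "h = min (d / 2) r0"
  have "0 < h" "h < d" "r0 - h \<in> {0..S}" using d(1) r0 by (auto simp: h_def min_def)
  with d(2)[of h] max[of "r0 - h" x0 y0] show False by simp
qed

section \<open>Bounds for classical solutions\<close>

lemma classical_solution_on_uminus:
  assumes "classical_solution_on S Q b u"
  shows "classical_solution_on S Q b (\<lambda>r x. - u r x)"
  unfolding classical_solution_on_def
proof (intro conjI ballI allI)
  show "continuous_on ({0..S} \<times> UNIV) (\<lambda>(r, x). - u r x)"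
    using assms unfolding classical_solution_on_def case_prod_beta by (intro continuous_intros) auto
next
  fix r x assume r: "r \<in> {0<..S}"
  obtain g H where j: "second_order_jet (u r) x g H"
    "((\<lambda>r. u r x) has_real_derivative trace (Q r ** H) + b r x \<bullet> g) (at r)"
    using assms r unfolding classical_solution_on_def by blast
  have m: "(- H) *v \<xi> = - (H *v \<xi>)" for \<xi> using matrix_vector_mult_diff_rdistrib[of 0 H \<xi>] by simp
  have eq: "(- u r (x + h *\<^sub>R \<xi>) - - u r x - h * (- g \<bullet> \<xi>) - h\<^sup>2 / 2 * (\<xi> \<bullet> (- H *v \<xi>))) / h\<^sup>2
     = - ((u r (x + h *\<^sub>R \<xi>) - u r x - h * (g \<bullet> \<xi>) - h\<^sup>2 / 2 * (\<xi> \<bullet> (H *v \<xi>))) / h\<^sup>2)" for h \<xi>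
    unfolding m minus_divide_left by (rule arg_cong[where f="\<lambda>z. z / h\<^sup>2"]) (simp add: algebra_simps)
  show "\<exists>g H. second_order_jet (\<lambda>x. - u r x) x g H \<and>
      ((\<lambda>r. - u r x) has_real_derivative trace (Q r ** H) + b r x \<bullet> g) (at r)"
  proof (intro exI[of _ "- g"] exI[of _ "- H"] conjI)
    show "second_order_jet (\<lambda>x. - u r x) x (- g) (- H)"
      unfolding second_order_jet_def eq
    proof
      fix \<xi>
      show "((\<lambda>h. - ((u r (x + h *\<^sub>R \<xi>) - u r x - h * (g \<bullet> \<xi>) - h\<^sup>2 / 2 * (\<xi> \<bullet> (H *v \<xi>))) / h\<^sup>2)) \<longlongrightarrow> 0) (at 0)"
        using tendsto_minus[OF j(1)[unfolded second_order_jet_def, rule_format, of \<xi>]] by simp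
    qed
    show "((\<lambda>r. - u r x) has_real_derivative trace (Q r ** - H) + b r x \<bullet> - g) (at r)"
      using DERIV_minus[OF j(2)] by (simp add: trace_mult_linear)
  qed
qed

lemma classical_solution_on_const: "classical_solution_on S Q b (\<lambda>r x. M)"
  unfolding classical_solution_on_def second_order_jet_def
  by (auto intro!: exI[of _ 0] simp: trace_def matrix_matrix_mult_def)

text \<open>A constant solves every such equation, so this is the comparison with \<open>v = M\<close> and \<open>k = 0\<close>, as
\<open>\<epsilon>\<close> tends to zero.\<close>

lemma classical_solution_le_initial_bound:
  fixes u :: "real \<Rightarrow> real^'n::finite \<Rightarrow> real"
  assumes u: "classical_solution_on S Q b u"
    and phi: "continuous_on UNIV \<phi>" "filterlim \<phi> at_top at_infinity" "\<And>x. 0 \<le> \<phi> x"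
    and jet: "\<And>x. second_order_jet \<phi> x (g x) (H x)"
    and lyap: "\<And>r x. r \<in> {0<..S} \<Longrightarrow> trace (Q r ** H x) + b r x \<bullet> g x \<le> a - c * \<phi> x"
    and ac: "0 < c" "0 \<le> a"
    and psd: "\<And>r. r \<in> {0<..S} \<Longrightarrow> psd (Q r)"
    and bound: "\<And>r x. r \<in> {0..S} \<Longrightarrow> u r x \<le> B"
    and init: "\<And>x. u 0 x \<le> M"
    and r: "r \<in> {0..S}"
  shows "u r x \<le> M"
proof -
  define E where "E = exp (- c * r) * (\<phi> x + \<phi> x) + 2 * (a + 1) / c * (1 - exp (- c * r))"
  have le: "u r x - M \<le> \<epsilon> * E" if \<epsilon>: "\<epsilon> > 0" for \<epsilon>
  proof -
    \<comment> \<open>With \<open>k = 0\<close> nothing has to be shared, so the common part of the noise may be \<open>0\<close>.\<close>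
    have "psd (0 :: real^'n^'n)" by (simp add: psd_def transpose_def vec_eq_iff)
    have "u r x - M \<le> 0 + 0 * (exp (0 * r) * (norm (x - x))\<^sup>2 + 0 * r) + \<epsilon> * (exp (- c * r) * (\<phi> x + \<phi> x) + 2 * (a + 1) / c * (1 - exp (- c * r)))"
    proof (rule doubling_comparison[OF u classical_solution_on_const[of _ Q b] phi jet lyap lyap ac \<open>psd 0\<close> _ _ _ \<epsilon> _ _ _ _ _ _ r])
      show "u r x - M \<le> B - M" if "r \<in> {0..S}" for r x using bound[OF that] by simp
      show "u 0 x - M \<le> 0 + 0 * (norm (x - y))\<^sup>2 + \<epsilon> * (\<phi> x + \<phi> y)" for x y
        using init[of x] phi(3)[of x] phi(3)[of y] \<epsilon>
        by (simp add: add_nonneg_nonneg order_trans[of "u 0 x - M" 0])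
    qed (use psd in auto)
    then show ?thesis by (simp add: E_def)
  qed
  have "((\<lambda>\<epsilon>. \<epsilon> * E) \<longlongrightarrow> 0 * E) (at_right 0)" by (intro tendsto_intros)
  then have "u r x - M \<le> 0 * E"
    by (rule tendsto_lowerbound) (auto simp: eventually_at_right_field le intro!: exI[of _ 1])
  then show ?thesis by simp
qed

text \<open>Time is shifted so that the initial time becomes \<open>0\<close>, which puts all solutions on a common interval.\<close>

lemma classical_solution_on_if_bounded_classical_solution:
  assumes "bounded_classical_solution (\<lambda>t. kolmogorov_op (Q t) (b t)) s f u"
  shows "classical_solution_on S (\<lambda>r. Q (s + r)) (\<lambda>r. b (s + r)) (\<lambda>r. u (s + r))"
  unfolding classical_solution_on_def
proof (intro conjI ballI allI)
  have c: "continuous_on ({s..} \<times> UNIV) (\<lambda>(t, x). u t x)"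
    and C: "C12_after s u" and eq: "\<And>t x. t > s \<Longrightarrow> deriv (\<lambda>r. u r x) t = kolmogorov_op (Q t) (b t) (u t) x"
    using assms unfolding bounded_classical_solution_def by blast+
  show "continuous_on ({0..S} \<times> UNIV) (\<lambda>(r, x). u (s + r) x)"
    using continuous_on_compose2[OF c, of "{0..S} \<times> UNIV" "\<lambda>p. (s + fst p, snd p)"]
    by (force intro!: continuous_intros simp: case_prod_beta)
  fix r x assume r: "r \<in> {0<..S}"
  then have t: "s + r > s" by simp
  have slice: "continuous_on UNIV (w (s + r))"
    if "continuous_on ({s<..} \<times> UNIV) (\<lambda>(t, x). w t x)" for w :: "real \<Rightarrow> real^'a \<Rightarrow> real"
    using continuous_on_compose2[OF that, of UNIV "\<lambda>x. (s + r, x)"] t by (force intro!: continuous_intros)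
  have "second_order_jet (u (s + r)) x (grad (u (s + r)) x) (hessian (u (s + r)) x)"
  proof (rule second_order_jet_if_continuous_partials)
    fix i j
    show "has_partial i (u (s + r)) y" "has_partial i (partial j (u (s + r))) y" for y
      using C t unfolding C12_after_def by blast+
    show "continuous_on UNIV (partial i (u (s + r)))"
      using slice[of "\<lambda>t. partial i (u t)"] C unfolding C12_after_def by blast
    show "continuous_on UNIV (partial i (partial j (u (s + r))))"
      using slice[of "\<lambda>t. partial i (partial j (u t))"] C unfolding C12_after_def by blast
  qed
  moreover have "((\<lambda>t. u t x) has_real_derivative
      trace (Q (s + r) ** hessian (u (s + r)) x) + b (s + r) x \<bullet> grad (u (s + r)) x) (at (s + r))"
    using C t eq[OF t, of x] unfolding C12_after_def kolmogorov_op_def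
    by (metis DERIV_deriv_iff_field_differentiable)
  then have "((\<lambda>r. u (s + r) x) has_real_derivative
      trace (Q (s + r) ** hessian (u (s + r)) x) + b (s + r) x \<bullet> grad (u (s + r)) x) (at r)"
    using DERIV_at_within_shift[of "\<lambda>t. u t x" _ s r UNIV] by simp
  ultimately show "\<exists>g H. second_order_jet (u (s + r)) x g H \<and>
      ((\<lambda>r. u (s + r) x) has_real_derivative trace (Q (s + r) ** H) + b (s + r) x \<bullet> g) (at r)" by blast
qed

text \<open>Each solution is bounded by hypothesis, but with a bound of its own; the maximum principle replaces it by the
bound of the initial datum, which is uniform in the initial time.\<close>

lemma bounded_classical_solution_abs_le:
  fixes f :: "real^'n::finite \<Rightarrow> real"
  assumes w: "bounded_classical_solution (\<lambda>t. kolmogorov_op (Q t) (b t)) s f w"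
    and phi: "continuous_on UNIV \<phi>" "filterlim \<phi> at_top at_infinity" "\<And>x. 0 \<le> \<phi> x"
    and jet: "\<And>x. second_order_jet \<phi> x (g x) (H x)"
    and lyap: "\<And>t x. t > s \<Longrightarrow> trace (Q t ** H x) + b t x \<bullet> g x \<le> a - c * \<phi> x"
    and ac: "0 < c" "0 \<le> a"
    and psd: "\<And>t. t > s \<Longrightarrow> psd (Q t)"
    and f: "\<And>x. \<bar>f x\<bar> \<le> M" and r: "0 \<le> r"
  shows "\<bar>w (s + r) x\<bar> \<le> M"
proof -
  have sol: "classical_solution_on r (\<lambda>r. Q (s + r)) (\<lambda>r. b (s + r)) (\<lambda>r. w (s + r))"
    by (rule classical_solution_on_if_bounded_classical_solution[OF w])
  have ws: "w s = f" and "bounded ((\<lambda>(t, x). w t x) ` ({s..} \<times> UNIV))"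
    using w unfolding bounded_classical_solution_def by blast+
  then obtain B where "\<And>z. z \<in> (\<lambda>(t, x). w t x) ` ({s..} \<times> UNIV) \<Longrightarrow> norm z \<le> B"
    unfolding bounded_iff by blast
  then have B: "\<bar>w t x\<bar> \<le> B" if "t \<ge> s" for t x using that by force
  have "w (s + r) x \<le> M"
  proof (rule classical_solution_le_initial_bound[OF sol phi jet _ ac])
    show "w (s + r') x \<le> B" if "r' \<in> {0..r}" for r' x using B[of "s + r'" x] that by auto
    show "w (s + 0) x \<le> M" for x using f[of x] ws by (simp add: abs_le_iff)
  qed (use lyap psd r in auto)
  moreover have "- w (s + r) x \<le> M"
  proof (rule classical_solution_le_initial_bound[OF classical_solution_on_uminus[OF sol] phi jet _ ac])
    show "- w (s + r') x \<le> B" if "r' \<in> {0..r}" for r' x using B[of "s + r'" x] that by auto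
    show "- w (s + 0) x \<le> M" for x using f[of x] ws by (simp add: abs_le_iff)
  qed (use lyap psd r in auto)
  ultimately show ?thesis by linarith
qed

section \<open>Dissipative drifts\<close>

text \<open>Mean value theorem for the component of \<open>b\<close> along \<open>x - y\<close> on the segment from \<open>y\<close> to \<open>x\<close>.\<close>

lemma one_sided_lipschitz_if_jacobian:
  fixes b :: "real^'n::finite \<Rightarrow> real^'n"
  assumes ex: "\<And>i j x. has_partial j (\<lambda>y. b y $ i) x"
    and cont: "\<And>i j. continuous_on UNIV (partial j (\<lambda>y. b y $ i))"
    and jac: "\<And>x \<xi>. (jacobian_matrix b x *v \<xi>) \<bullet> \<xi> \<le> \<rho> * (norm \<xi>)\<^sup>2"
  shows "(b x - b y) \<bullet> (x - y) \<le> \<rho> * (norm (x - y))\<^sup>2"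
proof -
  define d where "d = x - y"
  define q where "q s = b (y + s *\<^sub>R d) \<bullet> d" for s :: real
  have "(q has_real_derivative (jacobian_matrix b (y + s *\<^sub>R d) *v d) \<bullet> d) (at s)" for s
  proof -
    have "((\<lambda>s. \<Sum>i\<in>UNIV. b (y + s *\<^sub>R d) $ i * d $ i) has_real_derivative
        (\<Sum>i\<in>UNIV. (grad (\<lambda>y. b y $ i) (y + s *\<^sub>R d) \<bullet> d) * d $ i)) (at s)"
      by (intro DERIV_sum DERIV_cmult_right has_real_derivative_along_line[of "\<lambda>y. b y $ i" for i] ex cont)
    moreover have "(\<Sum>i\<in>UNIV. (grad (\<lambda>y. b y $ i) (y + s *\<^sub>R d) \<bullet> d) * d $ i) = (jacobian_matrix b (y + s *\<^sub>R d) *v d) \<bullet> d"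
      by (simp add: grad_def jacobian_matrix_def inner_vec_def matrix_vector_mult_def)
    ultimately show ?thesis by (simp add: q_def[abs_def] inner_vec_def)
  qed
  from MVT2[OF zero_less_one this] obtain s where
    "q 1 - q 0 = (1 - 0) * ((jacobian_matrix b (y + s *\<^sub>R d) *v d) \<bullet> d)" by blast
  then have "q 1 - q 0 \<le> \<rho> * (norm d)\<^sup>2" using jac[of "y + s *\<^sub>R d" d] by simp
  then show ?thesis by (simp add: q_def d_def inner_diff_left)
qed

text \<open>The fields \<open>b t\<close> converge only pointwise and need not be equicontinuous, yet they are monotone up
to a linear term. If \<open>z\<close> is close to \<open>y\<close>, then
\<open>b t x - b' y = (b t x - b t z) + (b t z - b' z) + (b' z - b' y)\<close>. The first difference is controlled by
the one-sided condition and the local bound, the last by continuity of \<open>b'\<close>, and the middle one by pointwise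
convergence, since \<open>z\<close> may be taken from a finite net of the compact set.\<close>

lemma eventually_drift_dissipative_against_limit:
  fixes b :: "real \<Rightarrow> 'a::euclidean_space \<Rightarrow> 'a"
  assumes K: "compact K"
    and osl: "\<And>t x y. t > t\<^sub>0 \<Longrightarrow> (b t x - b t y) \<bullet> (x - y) \<le> \<rho> * (norm (x - y))\<^sup>2" and \<rho>: "\<rho> \<le> 0"
    and bdd: "\<And>t x. t > t\<^sub>0 \<Longrightarrow> x \<in> K \<Longrightarrow> norm (b t x) \<le> C"
    and lim: "\<And>x. ((\<lambda>t. b t x) \<longlongrightarrow> b' x) at_top"
    and cont: "continuous_on UNIV b'" and \<eta>: "0 < \<eta>"
  shows "\<forall>\<^sub>F t in at_top. \<forall>x\<in>K. \<forall>y\<in>K. (b t x - b' y) \<bullet> (x - y) \<le> \<rho> * (norm (x - y))\<^sup>2 + \<eta>"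
proof -
  obtain D where D: "D > 0" "\<And>x y. x \<in> K \<Longrightarrow> y \<in> K \<Longrightarrow> norm (x - y) \<le> D"
  proof -
    obtain a where a: "\<And>x. x \<in> K \<Longrightarrow> norm x \<le> a" "a > 0"
      using compact_imp_bounded[OF K] bounded_pos by blast
    show ?thesis
    proof (rule that[of "2 * a"])
      fix x y assume "x \<in> K" "y \<in> K"
      with a(1)[of x] a(1)[of y] norm_triangle_ineq4[of x y] show "norm (x - y) \<le> 2 * a" by simp
    qed (use a in auto)
  qed
  define C' where "C' = max C 1"
  have C': "C' > 0" "\<And>t x. t > t\<^sub>0 \<Longrightarrow> x \<in> K \<Longrightarrow> norm (b t x) \<le> C'"
    using bdd by (auto simp: C'_def le_max_iff_disj)
  define \<omega> where "\<omega> = \<eta> / (4 * D)"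
  have \<omega>: "\<omega> > 0" "\<omega> * D = \<eta> / 4" using \<eta> D by (auto simp: \<omega>_def)
  have "uniformly_continuous_on K b'"
    by (rule compact_uniformly_continuous[OF continuous_on_subset[OF cont] K]) simp
  then obtain \<sigma>1 where \<sigma>1: "\<sigma>1 > 0" "\<And>x y. x \<in> K \<Longrightarrow> y \<in> K \<Longrightarrow> dist y x < \<sigma>1 \<Longrightarrow> dist (b' y) (b' x) < \<omega>"
    unfolding uniformly_continuous_on_def using \<omega> by metis
  define \<sigma> where "\<sigma> = min \<sigma>1 (min (\<eta> / (8 * C')) (\<eta> / (8 * D * (1 - \<rho>))))"
  have \<sigma>: "\<sigma> > 0" "\<sigma> \<le> \<sigma>1" "2 * C' * \<sigma> \<le> \<eta> / 4" "- \<rho> * (\<sigma> * (2 * D)) \<le> \<eta> / 4"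
  proof -
    show "\<sigma> > 0" "\<sigma> \<le> \<sigma>1" using \<eta> D C' \<sigma>1 \<rho> by (auto simp: \<sigma>_def)
    have "\<sigma> \<le> \<eta> / (8 * C')" "\<sigma> \<le> \<eta> / (8 * D * (1 - \<rho>))" by (auto simp: \<sigma>_def)
    then have a: "\<sigma> * (8 * C') \<le> \<eta>" "\<sigma> * (8 * D * (1 - \<rho>)) \<le> \<eta>"
      using C' D \<rho> by (simp_all add: pos_le_divide_eq)
    from a(1) show "2 * C' * \<sigma> \<le> \<eta> / 4" by (simp add: algebra_simps)
    have "0 \<le> \<sigma> * (8 * D)" using \<open>\<sigma> > 0\<close> D by simp
    with a(2) show "- \<rho> * (\<sigma> * (2 * D)) \<le> \<eta> / 4" by (simp add: algebra_simps)
  qed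
  obtain Z where Z: "Z \<subseteq> K" "finite Z" "K \<subseteq> (\<Union>z\<in>Z. ball z \<sigma>)"
    using compactE_image[OF K, of K "\<lambda>z. ball z \<sigma>"] \<sigma>(1) by (metis UN_I centre_in_ball open_ball subsetI)
  have "\<forall>\<^sub>F t in at_top. \<forall>z\<in>Z. dist (b t z) (b' z) < \<omega>"
    using Z(2) tendstoD[OF lim \<omega>(1)] by (simp add: eventually_ball_finite_distrib)
  with eventually_gt_at_top[of t\<^sub>0] show ?thesis
  proof eventually_elim
    case (elim t)
    show ?case
    proof (intro ballI)
      fix x y assume xy: "x \<in> K" "y \<in> K"
      then obtain z where z: "z \<in> Z" "dist z y < \<sigma>" using Z(3) by auto
      then have zK: "z \<in> K" using Z(1) by auto
      have zy: "norm (z - y) \<le> \<sigma>" using z(2) by (simp add: dist_norm)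
      have split: "(b t x - b' y) \<bullet> (x - y) = (b t x - b t z) \<bullet> (x - z) + (b t x - b t z) \<bullet> (z - y)
          + (b t z - b' z) \<bullet> (x - y) + (b' z - b' y) \<bullet> (x - y)"
        by (simp add: algebra_simps)
      have 1: "(b t x - b t z) \<bullet> (x - z) \<le> \<rho> * (norm (x - y))\<^sup>2 + \<eta> / 4"
      proof -
        have "norm (x - y) \<le> norm (x - z) + norm (z - y)"
          using norm_triangle_ineq[of "x - z" "z - y"] by simp
        then have "norm (x - y) - norm (x - z) \<le> \<sigma>" using zy by simp
        moreover have "norm (x - y) + norm (x - z) \<le> 2 * D" using D(2)[OF xy] D(2)[OF xy(1) zK] by simp
        ultimately have "(norm (x - y) - norm (x - z)) * (norm (x - y) + norm (x - z)) \<le> \<sigma> * (2 * D)"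
          using \<sigma>(1) by (intro mult_mono) auto
        then have "(norm (x - y))\<^sup>2 - (norm (x - z))\<^sup>2 \<le> \<sigma> * (2 * D)"
          by (simp add: power2_eq_square algebra_simps)
        then have "- \<rho> * ((norm (x - y))\<^sup>2 - (norm (x - z))\<^sup>2) \<le> - \<rho> * (\<sigma> * (2 * D))"
          using \<rho> by (intro mult_left_mono) auto
        with \<sigma>(4) have "- \<rho> * ((norm (x - y))\<^sup>2 - (norm (x - z))\<^sup>2) \<le> \<eta> / 4" by linarith
        with osl[OF elim(1), of x z] show ?thesis by (simp add: algebra_simps)
      qed
      have 2: "(b t x - b t z) \<bullet> (z - y) \<le> \<eta> / 4"
      proof -
        have "(b t x - b t z) \<bullet> (z - y) \<le> norm (b t x - b t z) * norm (z - y)" by (rule norm_cauchy_schwarz)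
        also have "\<dots> \<le> (2 * C') * \<sigma>"
        proof (intro mult_mono)
          show "norm (b t x - b t z) \<le> 2 * C'"
            using norm_triangle_ineq4[of "b t x" "b t z"] C'(2)[OF elim(1) xy(1)] C'(2)[OF elim(1) zK] by simp
        qed (use zy C' in auto)
        finally show ?thesis using \<sigma>(3) by simp
      qed
      have 3: "(b t z - b' z) \<bullet> (x - y) \<le> \<eta> / 4"
      proof -
        have "(b t z - b' z) \<bullet> (x - y) \<le> norm (b t z - b' z) * norm (x - y)" by (rule norm_cauchy_schwarz)
        also have "\<dots> \<le> \<omega> * D" using elim(2) z(1) D xy \<omega> by (intro mult_mono) (auto simp: dist_norm less_imp_le)
        finally show ?thesis using \<omega>(2) by simp
      qed
      have 4: "(b' z - b' y) \<bullet> (x - y) \<le> \<eta> / 4"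
      proof -
        have "norm (b' z - b' y) \<le> \<omega>" using \<sigma>1(2)[OF xy(2) zK] z(2) \<sigma>(2) by (simp add: dist_norm)
        have "(b' z - b' y) \<bullet> (x - y) \<le> norm (b' z - b' y) * norm (x - y)" by (rule norm_cauchy_schwarz)
        also have "\<dots> \<le> \<omega> * D" using \<open>norm (b' z - b' y) \<le> \<omega>\<close> D xy \<omega> by (intro mult_mono) auto
        finally show ?thesis using \<omega>(2) by simp
      qed
      show "(b t x - b' y) \<bullet> (x - y) \<le> \<rho> * (norm (x - y))\<^sup>2 + \<eta>"
        unfolding split using 1 2 3 4 by linarith
    qed
  qed
qed

section \<open>Integrals against tight measures\<close>

text \<open>Outside the ball \<open>|h - z| \<le> 2M\<close>.\<close>

lemma integral_near_constant:
  fixes h :: "real^'n::finite \<Rightarrow> real"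
  assumes N: "borel_prob N" and h: "continuous_on UNIV h" "\<And>x. \<bar>h x\<bar> \<le> M"
    and near: "\<And>x. x \<in> ball 0 R \<Longrightarrow> \<bar>h x - z\<bar> \<le> \<eta>" and z: "\<bar>z\<bar> \<le> M" and \<eta>: "0 \<le> \<eta>"
    and tail: "measure N (- ball 0 R) \<le> \<eta>'"
  shows "\<bar>(LINT x|N. h x) - z\<bar> \<le> \<eta> + 2 * M * \<eta>'"
proof -
  interpret prob_space N using N by (simp add: borel_prob_def)
  have sets: "sets N = sets borel" using N by (simp add: borel_prob_def)
  have M: "0 \<le> M" using z by linarith
  have [measurable]: "h \<in> borel_measurable N"
    using borel_measurable_continuous_onI[OF h(1)] by (simp add: measurable_cong_sets[OF sets refl])
  have [measurable]: "- ball (0 :: real^'n) R \<in> sets N" by (simp add: sets)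
  have int: "integrable N h" by (rule integrable_const_bound[of _ M]) (use h in auto)
  have int2: "integrable N (\<lambda>x. \<eta> + 2 * M * indicator (- ball 0 R) x)"
    by (intro Bochner_Integration.integrable_add integrable_mult_right integrable_const integrable_real_indicator)
      (auto simp: emeasure_eq_measure)
  have "\<bar>(LINT x|N. h x) - z\<bar> = \<bar>LINT x|N. h x - z\<bar>" using int by (simp add: prob_space)
  also have "\<dots> \<le> (LINT x|N. \<bar>h x - z\<bar>)" by (rule integral_abs_bound)
  also have "\<dots> \<le> (LINT x|N. \<eta> + 2 * M * indicator (- ball 0 R) x)"
  proof (rule integral_mono[OF _ int2])
    show "integrable N (\<lambda>x. \<bar>h x - z\<bar>)" using int by auto
    fix x
    show "\<bar>h x - z\<bar> \<le> \<eta> + 2 * M * indicator (- ball 0 R) x"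
    proof (cases "x \<in> ball 0 R")
      case False
      have "\<bar>h x - z\<bar> \<le> 2 * M" using h(2)[of x] z by linarith
      with False \<eta> show ?thesis by (simp add: indicator_def)
    qed (use near in simp)
  qed
  also have "\<dots> = \<eta> + 2 * M * measure N (- ball 0 R)"
    using int2 by (subst Bochner_Integration.integral_add) (auto simp: prob_space emeasure_eq_measure sets)
  also have "\<dots> \<le> \<eta> + 2 * M * \<eta>'" using tail M by (intro add_left_mono mult_left_mono) auto
  finally show ?thesis .
qed

lemma borel_prob_tail:
  fixes N :: "('a::real_normed_vector) measure"
  assumes "borel_prob N" "0 < \<epsilon>"
  shows "\<exists>R. measure N (- ball 0 R) \<le> \<epsilon>"
proof -
  interpret prob_space N using assms by (simp add: borel_prob_def)
  have sets: "sets N = sets borel" using assms by (simp add: borel_prob_def)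
  have "(\<lambda>n. measure N (- ball 0 (real n))) \<longlonglongrightarrow> measure N (\<Inter>n. - ball 0 (real n))"
    by (rule finite_Lim_measure_decseq) (auto simp: sets decseq_def)
  moreover have "(\<Inter>n. - ball (0::'a) (real n)) = {}"
    by (auto simp: not_less) (meson reals_Archimedean2 not_le)
  ultimately have "(\<lambda>n. measure N (- ball 0 (real n))) \<longlonglongrightarrow> 0" by simp
  then have "\<forall>\<^sub>F n in sequentially. measure N (- ball 0 (real n)) < \<epsilon>" using assms by (intro order_tendstoD)
  then show ?thesis by (auto simp: eventually_sequentially intro: less_imp_le)
qed

section \<open>Asymptotically autonomous equations\<close>

text \<open>The structural hypotheses in the form in which the maximum principle uses them: the Lyapunov function comes with
its second-order expansions, and dissipativity of the Jacobian is replaced by the one-sided Lipschitz condition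
that it implies.\<close>

locale asymptotically_autonomous =
  fixes \<tau> a c \<eta>\<^sub>0 \<rho> :: real
    and Q :: "real \<Rightarrow> real^'n^'n::finite" and Q' :: "real^'n^'n"
    and b :: "real \<Rightarrow> real^'n \<Rightarrow> real^'n" and b' :: "real^'n \<Rightarrow> real^'n"
    and \<phi> :: "real^'n \<Rightarrow> real" and g :: "real^'n \<Rightarrow> real^'n" and H :: "real^'n \<Rightarrow> real^'n^'n"
  assumes Q_sym: "\<And>t. t > \<tau> \<Longrightarrow> transpose (Q t) = Q t"
    and \<eta>\<^sub>0: "0 < \<eta>\<^sub>0" and Q_ell: "\<And>t \<xi>. t > \<tau> \<Longrightarrow> \<eta>\<^sub>0 * (norm \<xi>)\<^sup>2 \<le> \<xi> \<bullet> (Q t *v \<xi>)"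
    and Q_lim: "(Q \<longlongrightarrow> Q') at_top"
    and phi: "continuous_on UNIV \<phi>" "filterlim \<phi> at_top at_infinity" "\<And>x. 0 \<le> \<phi> x"
    and jet: "\<And>x. second_order_jet \<phi> x (g x) (H x)"
    and ac: "0 < c" "0 \<le> a"
    and lyap: "\<And>t x. t > \<tau> \<Longrightarrow> trace (Q t ** H x) + b t x \<bullet> g x \<le> a - c * \<phi> x"
    and dissipative: "\<And>t x y. t > \<tau> \<Longrightarrow> (b t x - b t y) \<bullet> (x - y) \<le> \<rho> * (norm (x - y))\<^sup>2"
    and \<rho>: "\<rho> < 0"
    and b_bdd: "\<And>R. \<exists>t\<^sub>0 C. \<forall>t>t\<^sub>0. \<forall>x\<in>ball 0 R. norm (b t x) \<le> C"
    and b_lim: "\<And>x. ((\<lambda>t. b t x) \<longlongrightarrow> b' x) at_top"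
    and b'_cont: "continuous_on UNIV b'"

begin

lemma limit_sym: "transpose Q' = Q'"
proof -
  have "Q' $ i $ j = Q' $ j $ i" for i j
  proof (rule tendsto_unique[OF _ tendsto_vec_nth[OF tendsto_vec_nth[OF Q_lim]]])
    have "\<forall>\<^sub>F t in at_top. Q t $ j $ i = Q t $ i $ j"
      using eventually_gt_at_top[of \<tau>]
    proof eventually_elim
      case (elim t)
      have "Q t $ j $ i = transpose (Q t) $ i $ j" by (simp add: transpose_def)
      then show ?case using Q_sym[OF elim] by simp
    qed
    then show "((\<lambda>t. Q t $ i $ j) \<longlongrightarrow> Q' $ j $ i) at_top"
      by (rule Lim_transform_eventually[OF tendsto_vec_nth[OF tendsto_vec_nth[OF Q_lim]]])
  qed simp
  then show ?thesis by (simp add: transpose_def vec_eq_iff)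
qed

lemma limit_ell: "\<eta>\<^sub>0 * (norm \<xi>)\<^sup>2 \<le> \<xi> \<bullet> (Q' *v \<xi>)"
proof (rule tendsto_lowerbound)
  show "((\<lambda>t. \<xi> \<bullet> (Q t *v \<xi>)) \<longlongrightarrow> \<xi> \<bullet> (Q' *v \<xi>)) at_top"
    unfolding matrix_vector_mult_def inner_vec_def by simp (intro tendsto_intros Q_lim)
  show "\<forall>\<^sub>F t in at_top. \<eta>\<^sub>0 * (norm \<xi>)\<^sup>2 \<le> \<xi> \<bullet> (Q t *v \<xi>)"
    using eventually_gt_at_top[of \<tau>] by eventually_elim (rule Q_ell)
qed simp

lemma limit_lyap: "trace (Q' ** H x) + b' x \<bullet> g x \<le> a - c * \<phi> x"
proof (rule tendsto_upperbound)
  show "((\<lambda>t. trace (Q t ** H x) + b t x \<bullet> g x) \<longlongrightarrow> trace (Q' ** H x) + b' x \<bullet> g x) at_top"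
    by (intro tendsto_intros tendsto_trace Q_lim b_lim)
  show "\<forall>\<^sub>F t in at_top. trace (Q t ** H x) + b t x \<bullet> g x \<le> a - c * \<phi> x"
    using eventually_gt_at_top[of \<tau>] by eventually_elim (rule lyap)
qed simp

lemma psd_scaled_limit: "0 \<le> s \<Longrightarrow> psd (s *\<^sub>R Q')"
proof -
  assume s: "0 \<le> s"
  have "0 \<le> \<xi> \<bullet> (Q' *v \<xi>)" for \<xi>
    using order_trans[OF _ limit_ell[of \<xi>], of 0] \<eta>\<^sub>0 by simp
  with s limit_sym show ?thesis
    by (simp add: psd_def transpose_def vec_eq_iff scaleR_matrix_vector_assoc[symmetric])
qed

text \<open>The comparison with constants chosen in the order \<open>\<epsilon>\<close>, \<open>k\<close>, \<open>S\<close>, \<open>\<kappa>\<close>, \<open>\<theta>\<close>, \<open>t\<close>. The Lyapunov term is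
small on the ball for all \<open>r\<close>, since its coefficient \<open>1 - e\<^sup>-\<^sup>c\<^sup>r\<close> stays bounded; therefore \<open>\<epsilon>\<close> can be fixed before
\<open>S\<close>. Uniform continuity of \<open>f\<close> is needed only where \<open>\<epsilon> \<phi> \<le> 2M\<close>, so \<open>k\<close> depends on \<open>\<epsilon>\<close>, and \<open>S\<close> is then taken so
large that \<open>k e\<^sup>2\<^sup>\<rho>\<^sup>S |x - y|\<^sup>2\<close> is small. The statement holds for all \<open>S \<ge> S\<^sub>0\<close> so that it can be used for \<open>f\<close> and
\<open>-f\<close> with the same \<open>S\<close>.\<close>

lemma solutions_merge_one_sided:
  assumes f: "continuous_on UNIV f" "\<And>x. \<bar>f x\<bar> \<le> M"
    and u: "\<And>t S. t > \<tau> \<Longrightarrow> classical_solution_on S (\<lambda>r. Q (t + r)) (\<lambda>r. b (t + r)) (u t)"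
      "\<And>t. t > \<tau> \<Longrightarrow> u t 0 = f" "\<And>t r x. t > \<tau> \<Longrightarrow> 0 \<le> r \<Longrightarrow> \<bar>u t r x\<bar> \<le> M"
    and v: "\<And>S. classical_solution_on S (\<lambda>_. Q') (\<lambda>_. b') v"
      "v 0 = f" "\<And>r x. 0 \<le> r \<Longrightarrow> \<bar>v r x\<bar> \<le> M"
    and \<eta>: "0 < \<eta>"
  shows "\<exists>S\<^sub>0>0. \<forall>S\<ge>S\<^sub>0. \<forall>\<^sub>F t in at_top. \<forall>x\<in>ball 0 R. \<forall>y\<in>ball 0 R. u t S x - v S y \<le> \<eta>"
proof -
  have M: "0 \<le> M" using f(2)[of 0] by simp
  obtain P where P: "0 < P" "\<And>x. x \<in> ball 0 R \<Longrightarrow> \<phi> x \<le> P"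
  proof -
    have "compact (\<phi> ` cball 0 R)"
      by (intro compact_continuous_image continuous_on_subset[OF phi(1)] compact_cball) simp
    then obtain p where "p > 0" "\<And>y. y \<in> \<phi> ` cball 0 R \<Longrightarrow> norm y \<le> p"
      using compact_imp_bounded bounded_pos by metis
    then have "\<phi> x \<le> p" if "x \<in> ball 0 R" for x
      using that by (metis abs_le_D1 ball_subset_cball image_eqI real_norm_def subsetD)
    with \<open>p > 0\<close> show ?thesis by (rule that)
  qed
  define m where "m = 2 * P + 2 * (a + 1) / c"
  have m: "m > 0" using P ac by (simp add: m_def add_pos_pos)
  define \<epsilon> where "\<epsilon> = \<eta> / (4 * m)"
  have \<epsilon>: "\<epsilon> > 0" "\<epsilon> * m = \<eta> / 4" using \<eta> m by (auto simp: \<epsilon>_def)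
  define K\<^sub>0 where "K\<^sub>0 = {x. \<phi> x \<le> 2 * M / \<epsilon>}"
  have "compact K\<^sub>0" unfolding K\<^sub>0_def by (intro compact_sublevel phi)
  then have "uniformly_continuous_on K\<^sub>0 f"
    by (intro compact_uniformly_continuous continuous_on_subset[OF f(1)]) auto
  then obtain \<sigma> where \<sigma>: "\<sigma> > 0" "\<And>x y. x \<in> K\<^sub>0 \<Longrightarrow> y \<in> K\<^sub>0 \<Longrightarrow> dist y x < \<sigma> \<Longrightarrow> dist (f y) (f x) < \<eta> / 4"
    unfolding uniformly_continuous_on_def using \<eta> by (metis zero_less_divide_iff zero_less_numeral)
  \<comment> \<open>Beyond distance \<open>\<sigma>\<close> the quadratic term alone is at least the oscillation bound \<open>2M\<close> of \<open>f\<close>.\<close>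
  define k where "k = 2 * M / \<sigma>\<^sup>2"
  have k: "k \<ge> 0" "k * \<sigma>\<^sup>2 = 2 * M" using M \<sigma>(1) by (auto simp: k_def)
  have init: "f x - f y \<le> \<eta> / 4 + k * (norm (x - y))\<^sup>2 + \<epsilon> * (\<phi> x + \<phi> y)" for x y
  proof -
    have le2M: "f x - f y \<le> 2 * M" using f(2)[of x] f(2)[of y] by linarith
    have nn: "0 \<le> k * (norm (x - y))\<^sup>2" "0 \<le> \<epsilon> * \<phi> x" "0 \<le> \<epsilon> * \<phi> y"
      using k \<epsilon> phi(3) by simp_all
    consider "x \<notin> K\<^sub>0" | "y \<notin> K\<^sub>0" | "norm (x - y) \<ge> \<sigma>" | "x \<in> K\<^sub>0" "y \<in> K\<^sub>0" "norm (x - y) < \<sigma>" by fastforce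
    then show ?thesis
    proof cases
      case 1
      then have "2 * M < \<epsilon> * \<phi> x" using \<epsilon>(1) by (simp add: K\<^sub>0_def field_simps)
      with le2M nn \<eta> show ?thesis by (simp add: algebra_simps)
    next
      case 2
      then have "2 * M < \<epsilon> * \<phi> y" using \<epsilon>(1) by (simp add: K\<^sub>0_def field_simps)
      with le2M nn \<eta> show ?thesis by (simp add: algebra_simps)
    next
      case 3
      then have "k * \<sigma>\<^sup>2 \<le> k * (norm (x - y))\<^sup>2" using k \<sigma> by (intro mult_left_mono power_mono) auto
      with k(2) le2M nn \<eta> show ?thesis by (simp add: algebra_simps)
    next
      case 4
      then have "\<bar>f x - f y\<bar> < \<eta> / 4" using \<sigma>(2)[of y x] by (simp add: dist_norm)
      then have "f x - f y \<le> \<eta> / 4" by linarith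
      with nn show ?thesis by (simp add: algebra_simps)
    qed
  qed
  have "((\<lambda>S. k * (exp (2 * \<rho> * S) * (2 * R)\<^sup>2)) \<longlongrightarrow> k * (0 * (2 * R)\<^sup>2)) at_top"
  proof (intro tendsto_intros)
    have "filterlim (\<lambda>S. (2 * \<rho>) * S) at_bot at_top"
      using \<rho> by (intro filterlim_tendsto_neg_mult_at_bot[OF tendsto_const] filterlim_ident) auto
    then show "((\<lambda>S. exp (2 * \<rho> * S)) \<longlongrightarrow> 0) at_top"
      by (rule filterlim_compose[OF exp_at_bot])
  qed
  then have "\<forall>\<^sub>F S in at_top. k * (exp (2 * \<rho> * S) * (2 * R)\<^sup>2) < \<eta> / 4"
    using \<eta> by (intro order_tendstoD) auto
  then obtain S\<^sub>1 where S\<^sub>1: "\<And>S. S \<ge> S\<^sub>1 \<Longrightarrow> k * (exp (2 * \<rho> * S) * (2 * R)\<^sup>2) < \<eta> / 4"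
    by (auto simp: eventually_at_top_linorder)
  have "\<forall>\<^sub>F t in at_top. \<forall>x\<in>ball 0 R. \<forall>y\<in>ball 0 R. u t S x - v S y \<le> \<eta>" if S: "S \<ge> max S\<^sub>1 1" for S
  proof -
    have S1: "S \<ge> S\<^sub>1" "S \<ge> 1" using S by auto
    define \<kappa> where "\<kappa> = \<eta> / (4 * (k + 1) * S)"
    have \<kappa>: "\<kappa> > 0" "k * (\<kappa> * S) \<le> \<eta> / 4"
    proof -
      show pos: "\<kappa> > 0" using \<eta> k S1 by (simp add: \<kappa>_def)
      have "l * (\<eta> / (4 * l * S) * S) = \<eta> / 4" if "l > 0" for l using that S1 by simp
      from this[of "k + 1"] have "(k + 1) * (\<kappa> * S) = \<eta> / 4" using k unfolding \<kappa>_def by simp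
      moreover have "0 \<le> \<kappa> * S" using pos S1 by simp
      ultimately show "k * (\<kappa> * S) \<le> \<eta> / 4" by (simp add: algebra_simps)
    qed
    \<comment> \<open>The parts of the noise that are not shared, \<open>Q (t + r) - Q\<^sub>0\<close> and \<open>Q' - Q\<^sub>0 = \<theta> Q'\<close>, have traces of order \<open>\<theta>\<close>.\<close>
    define \<theta> where "\<theta> = min 1 (\<kappa> / (8 * (1 + \<bar>trace Q'\<bar>)))"
    have \<theta>: "0 < \<theta>" "\<theta> \<le> 1" "2 * \<theta> + 4 * \<theta> * trace Q' \<le> \<kappa> / 2"
    proof -
      show pos: "0 < \<theta>" "\<theta> \<le> 1" using \<kappa> by (auto simp: \<theta>_def)
      have "\<theta> \<le> \<kappa> / (8 * (1 + \<bar>trace Q'\<bar>))" by (simp add: \<theta>_def)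
      then have "\<theta> * (8 * (1 + \<bar>trace Q'\<bar>)) \<le> \<kappa>" by (subst (asm) pos_le_divide_eq) auto
      then have "8 * \<theta> + 8 * (\<theta> * \<bar>trace Q'\<bar>) \<le> \<kappa>" by (simp add: algebra_simps)
      moreover have "\<theta> * trace Q' \<le> \<theta> * \<bar>trace Q'\<bar>" using pos by (intro mult_left_mono) auto
      ultimately show "2 * \<theta> + 4 * \<theta> * trace Q' \<le> \<kappa> / 2" using pos by linarith
    qed
    define Q\<^sub>0 where "Q\<^sub>0 = (1 - \<theta>) *\<^sub>R Q'"
    \<comment> \<open>The region in which hypothesis \<open>coupling\<close> of the comparison has to be checked.\<close>
    define K where "K = {x. \<phi> x \<le> 2 * M / (\<epsilon> * exp (- c * S))}"
    have K: "compact K" unfolding K_def by (intro compact_sublevel phi)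
    obtain R' where R': "K \<subseteq> ball 0 R'"
      using bounded_subset_ballD[OF compact_imp_bounded[OF K], of 0] by blast
    obtain t\<^sub>0 C where bC: "\<And>t x. t > t\<^sub>0 \<Longrightarrow> x \<in> ball 0 R' \<Longrightarrow> norm (b t x) \<le> C"
      using b_bdd[of R'] by blast
    have ev1: "\<forall>\<^sub>F t in at_top. \<forall>x\<in>K. \<forall>y\<in>K. (b t x - b' y) \<bullet> (x - y) \<le> \<rho> * (norm (x - y))\<^sup>2 + \<kappa> / 4"
    proof (rule eventually_drift_dissipative_against_limit[where t\<^sub>0 = "max \<tau> t\<^sub>0" and C = C])
      show "(b t x - b t y) \<bullet> (x - y) \<le> \<rho> * (norm (x - y))\<^sup>2" if "t > max \<tau> t\<^sub>0" for t x y
        using dissipative that by simp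
      show "norm (b t x) \<le> C" if "t > max \<tau> t\<^sub>0" "x \<in> K" for t x using bC[of t x] that R' by auto
    qed (use K \<rho> b_lim b'_cont \<kappa> in auto)
    have ev2: "\<forall>\<^sub>F t in at_top. psd (Q t - Q\<^sub>0)" unfolding Q\<^sub>0_def
    proof (rule eventually_psd_minus_shrunk_limit[OF Q_lim _ limit_sym limit_ell \<eta>\<^sub>0 \<theta>(1)])
      show "\<forall>\<^sub>F t in at_top. transpose (Q t) = Q t"
        using eventually_gt_at_top[of \<tau>] by eventually_elim (rule Q_sym)
    qed
    have ev3: "\<forall>\<^sub>F t in at_top. trace (Q t) < trace Q' + \<theta>"
      using \<theta>(1) by (intro order_tendstoD(2)[OF tendsto_trace(2)[OF Q_lim]]) auto
    have "\<forall>\<^sub>F t in at_top. t > \<tau> \<and> psd (Q t - Q\<^sub>0) \<and> trace (Q t) < trace Q' + \<theta> \<and>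
        (\<forall>x\<in>K. \<forall>y\<in>K. (b t x - b' y) \<bullet> (x - y) \<le> \<rho> * (norm (x - y))\<^sup>2 + \<kappa> / 4)"
      using eventually_gt_at_top[of \<tau>] ev1 ev2 ev3 by eventually_elim auto
    then obtain N where N: "\<And>t. t \<ge> N \<Longrightarrow> t > \<tau> \<and> psd (Q t - Q\<^sub>0) \<and> trace (Q t) < trace Q' + \<theta> \<and>
        (\<forall>x\<in>K. \<forall>y\<in>K. (b t x - b' y) \<bullet> (x - y) \<le> \<rho> * (norm (x - y))\<^sup>2 + \<kappa> / 4)"
      by (auto simp: eventually_at_top_linorder)
    have "u t S x - v S y \<le> \<eta>" if t: "t \<ge> N" and xy: "x \<in> ball 0 R" "y \<in> ball 0 R" for t x y
    proof -
      have t\<tau>: "t > \<tau>" using N[OF t] by simp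
      have psd0: "psd Q\<^sub>0" unfolding Q\<^sub>0_def using \<theta> by (intro psd_scaled_limit) simp
      have Q'0: "Q' - Q\<^sub>0 = \<theta> *\<^sub>R Q'" by (simp add: Q\<^sub>0_def algebra_simps)
      have "u t S x - v S y \<le> \<eta> / 4 + k * (exp ((2 * \<rho>) * S) * (norm (x - y))\<^sup>2 + \<kappa> * S)
        + \<epsilon> * (exp (- c * S) * (\<phi> x + \<phi> y) + 2 * (a + 1) / c * (1 - exp (- c * S)))"
      proof (rule doubling_comparison[OF u(1)[OF t\<tau>] v(1) phi jet _ limit_lyap ac psd0, where B = "2 * M"])
        show "u t r x - v r y \<le> 2 * M" if "r \<in> {0..S}" for r x y
          using u(3)[OF t\<tau>, of r x] v(3)[of r y] that by (simp add: abs_le_iff)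
        show "u t 0 x - v 0 y \<le> \<eta> / 4 + k * (norm (x - y))\<^sup>2 + \<epsilon> * (\<phi> x + \<phi> y)" for x y
          using init u(2)[OF t\<tau>] v(2) by simp
        fix r x assume r: "r \<in> {0<..S}"
        then have tr: "t + r > \<tau>" "t + r \<ge> N" using t t\<tau> by auto
        show "trace (Q (t + r) ** H x) + b (t + r) x \<bullet> g x \<le> a - c * \<phi> x" using lyap tr by simp
        show "psd (Q (t + r) - Q\<^sub>0)" using N[OF tr(2)] by simp
        show "psd (Q' - Q\<^sub>0)" unfolding Q'0 using \<theta> by (intro psd_scaled_limit) simp
        fix y assume reg: "\<epsilon> * exp (- c * S) * (\<phi> x + \<phi> y) \<le> 2 * M"
        then have "\<phi> x + \<phi> y \<le> 2 * M / (\<epsilon> * exp (- c * S))" using \<epsilon>(1) by (simp add: field_simps)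
        then have "x \<in> K" "y \<in> K" using phi(3)[of x] phi(3)[of y] by (auto simp: K_def)
        then have d: "(b (t + r) x - b' y) \<bullet> (x - y) \<le> \<rho> * (norm (x - y))\<^sup>2 + \<kappa> / 4" using N[OF tr(2)] by blast
        have "trace (Q' - Q\<^sub>0) = \<theta> * trace Q'" unfolding Q'0 by (simp add: trace_def sum_distrib_left)
        moreover from this have "trace (Q (t + r) - Q\<^sub>0) = trace (Q (t + r)) - trace Q' + \<theta> * trace Q'"
          by (simp add: trace_sub)
        ultimately have "2 * trace (Q (t + r) - Q\<^sub>0) + 2 * trace (Q' - Q\<^sub>0) \<le> \<kappa> / 2"
          using N[OF tr(2)] \<theta>(3) by simp
        with d have "2 * trace (Q (t + r) - Q\<^sub>0) + 2 * trace (Q' - Q\<^sub>0) + 2 * ((b (t + r) x - b' y) \<bullet> (x - y))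
          \<le> 2 * \<rho> * (norm (x - y))\<^sup>2 + \<kappa>" by simp
        then show "k * (2 * trace (Q (t + r) - Q\<^sub>0) + 2 * trace (Q' - Q\<^sub>0) + 2 * ((b (t + r) x - b' y) \<bullet> (x - y)))
          \<le> k * (2 * \<rho> * (norm (x - y))\<^sup>2 + \<kappa>)" using k(1) by (rule mult_left_mono)
      qed (use \<epsilon> k \<eta> \<kappa> \<rho> S1 in auto)
      also have "k * (exp ((2 * \<rho>) * S) * (norm (x - y))\<^sup>2 + \<kappa> * S) \<le> \<eta> / 4 + \<eta> / 4"
      proof -
        have "norm (x - y) \<le> 2 * R" using xy norm_triangle_ineq4[of x y] by simp
        then have "k * (exp ((2 * \<rho>) * S) * (norm (x - y))\<^sup>2) \<le> k * (exp ((2 * \<rho>) * S) * (2 * R)\<^sup>2)"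
          using k by (intro mult_left_mono power_mono) auto
        with S\<^sub>1[OF S1(1)] \<kappa>(2) show ?thesis by (simp add: algebra_simps)
      qed
      also have "\<epsilon> * (exp (- c * S) * (\<phi> x + \<phi> y) + 2 * (a + 1) / c * (1 - exp (- c * S))) \<le> \<epsilon> * m"
      proof -
        have "exp (- c * S) * (\<phi> x + \<phi> y) \<le> 1 * (2 * P)"
          using P(2)[OF xy(1)] P(2)[OF xy(2)] phi(3)[of x] phi(3)[of y] ac S1 by (intro mult_mono) auto
        moreover have "2 * (a + 1) / c * (1 - exp (- c * S)) \<le> 2 * (a + 1) / c * 1"
          using ac by (intro mult_left_mono) auto
        ultimately show ?thesis unfolding m_def using \<epsilon> by (intro mult_left_mono) auto
      qed
      finally show ?thesis using \<epsilon>(2) by simp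
    qed
    then show ?thesis unfolding eventually_at_top_linorder by (intro exI[of _ N]) blast
  qed
  then show ?thesis by (intro exI[of _ "max S\<^sub>1 1"]) auto
qed

text \<open>The two signs of the difference come from \<open>f\<close> and \<open>-f\<close>. The bounds by \<open>M\<close> serve to discard the tails of the
measures.\<close>

lemma evolution_merges_with_semigroup:
  assumes f: "continuous_on UNIV f" "\<And>x. \<bar>f x\<bar> \<le> M"
    and u: "\<And>t. t > \<tau> \<Longrightarrow> bounded_classical_solution (\<lambda>t. kolmogorov_op (Q t) (b t)) t f (u t)"
    and v: "bounded_classical_solution (\<lambda>_. kolmogorov_op Q' b') 0 f v"
    and \<eta>: "0 < \<eta>"
  obtains S where "S > 0" "\<forall>\<^sub>F t in at_top. \<forall>x\<in>ball 0 R. \<forall>y\<in>ball 0 R. \<bar>u t (t + S) x - v S y\<bar> \<le> \<eta>"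
    "\<And>t x. t > \<tau> \<Longrightarrow> \<bar>u t (t + S) x\<bar> \<le> M" "\<And>x. \<bar>v S x\<bar> \<le> M"
proof -
  have psdQ: "psd (Q t)" if "t > \<tau>" for t
    using Q_sym[OF that] order_trans[OF _ Q_ell[OF that], of 0] \<eta>\<^sub>0 by (simp add: psd_def)
  have usol: "classical_solution_on S (\<lambda>r. Q (t + r)) (\<lambda>r. b (t + r)) (\<lambda>r. u t (t + r))" if "t > \<tau>" for t S
    by (rule classical_solution_on_if_bounded_classical_solution[OF u[OF that]])
  have ub: "\<bar>u t (t + r) x\<bar> \<le> M" if "t > \<tau>" "0 \<le> r" for t r x
    by (rule bounded_classical_solution_abs_le[OF u[OF that(1)] phi jet lyap ac psdQ f(2) that(2)]) (use that in auto)
  have u0: "u t t = f" if "t > \<tau>" for t using u[OF that] by (simp add: bounded_classical_solution_def)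
  have vsol: "classical_solution_on S (\<lambda>_. Q') (\<lambda>_. b') v" for S
    using classical_solution_on_if_bounded_classical_solution[of "\<lambda>_. Q'" "\<lambda>_. b'", OF v, of S] by simp
  have vb: "\<bar>v r x\<bar> \<le> M" if "0 \<le> r" for r x
    using bounded_classical_solution_abs_le[of "\<lambda>_. Q'" "\<lambda>_. b'", OF v phi jet limit_lyap ac _ f(2) that, of x]
      psd_scaled_limit[of 1] by simp
  have v0: "v 0 = f" using v by (simp add: bounded_classical_solution_def)
  obtain S1 where S1: "S1 > 0" "\<And>S. S \<ge> S1 \<Longrightarrow> \<forall>\<^sub>F t in at_top. \<forall>x\<in>ball 0 R. \<forall>y\<in>ball 0 R. u t (t + S) x - v S y \<le> \<eta>"
    using solutions_merge_one_sided[OF f, of "\<lambda>t r. u t (t + r)" v \<eta> R] usol ub u0 vsol vb v0 \<eta> by auto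
  have f': "continuous_on UNIV (\<lambda>x. - f x)" "\<And>x. \<bar>- f x\<bar> \<le> M" using f by (auto intro: continuous_intros)
  have "\<exists>S\<^sub>0>0. \<forall>S\<ge>S\<^sub>0. \<forall>\<^sub>F t in at_top. \<forall>x\<in>ball 0 R. \<forall>y\<in>ball 0 R. - u t (t + S) x - - v S y \<le> \<eta>"
  proof (rule solutions_merge_one_sided[OF f', of "\<lambda>t r x. - u t (t + r) x" "\<lambda>r x. - v r x" \<eta> R])
    show "classical_solution_on S (\<lambda>r. Q (t + r)) (\<lambda>r. b (t + r)) (\<lambda>r x. - u t (t + r) x)" if "t > \<tau>" for t S
      by (rule classical_solution_on_uminus[OF usol[OF that]])
    show "classical_solution_on S (\<lambda>_. Q') (\<lambda>_. b') (\<lambda>r x. - v r x)" for S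
      by (rule classical_solution_on_uminus[OF vsol])
  qed (use ub u0 vb v0 \<eta> in auto)
  then obtain S2 where S2: "S2 > 0" "\<And>S. S \<ge> S2 \<Longrightarrow> \<forall>\<^sub>F t in at_top. \<forall>x\<in>ball 0 R. \<forall>y\<in>ball 0 R. - u t (t + S) x - - v S y \<le> \<eta>"
    by blast
  show thesis
  proof (rule that[of "max S1 S2"])
    show "max S1 S2 > 0" using S1(1) by simp
    from S1(2)[of "max S1 S2"] S2(2)[of "max S1 S2"]
    show "\<forall>\<^sub>F t in at_top. \<forall>x\<in>ball 0 R. \<forall>y\<in>ball 0 R. \<bar>u t (t + max S1 S2) x - v (max S1 S2) y\<bar> \<le> \<eta>"
      by (simp add: eventually_conj_iff[symmetric] abs_le_iff) (auto elim: eventually_elim2)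
  qed (use ub vb S1(1) in auto)
qed

text \<open>Both integrals are compared with the single number \<open>z = (T(S)f)(0)\<close>.\<close>

theorem evolution_measures_tendsto_invariant_measure:
  fixes f :: "real^'n \<Rightarrow> real"
  assumes f: "f \<in> bcontfun"
    and G: "evolution_operator {\<tau><..} (\<lambda>t. kolmogorov_op (Q t) (b t)) G"
    and mu: "evolution_system_of_measures {\<tau><..} G \<mu>" and tight: "tight_family {\<tau><..} \<mu>"
    and T: "markov_semigroup (kolmogorov_op Q' b') T" and m: "invariant_measure T m"
  shows "((\<lambda>t. LINT x|\<mu> t. f x) \<longlongrightarrow> (LINT x|m. f x)) at_top"
proof (rule tendstoI)
  fix e :: real assume e: "0 < e"
  have fc: "continuous_on UNIV f" using f by (simp add: bcontfun_def)
  obtain M where M: "M > 0" "\<And>x. \<bar>f x\<bar> \<le> M"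
    using f unfolding bcontfun_def bounded_pos by auto
  have u: "bounded_classical_solution (\<lambda>t. kolmogorov_op (Q t) (b t)) t f (\<lambda>r. G r t f)" if "t > \<tau>" for t
    using G f that by (simp add: evolution_operator_def)
  have v: "bounded_classical_solution (\<lambda>_. kolmogorov_op Q' b') 0 f (\<lambda>r. T r f)"
    using T f by (simp add: markov_semigroup_def)
  define \<epsilon> where "\<epsilon> = e / (8 * M)"
  have \<epsilon>: "\<epsilon> > 0" "2 * M * \<epsilon> = e / 4" using e M by (auto simp: \<epsilon>_def)
  obtain R1 where R1: "R1 > 0" "\<And>t. t > \<tau> \<Longrightarrow> measure (\<mu> t) (- ball 0 R1) \<le> \<epsilon>"
    using tight \<epsilon>(1) unfolding tight_family_def by auto
  have mprob: "borel_prob m" using m by (simp add: invariant_measure_def)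
  obtain R2 where R2: "measure m (- ball 0 R2) \<le> \<epsilon>" using borel_prob_tail[OF mprob \<epsilon>(1)] by blast
  obtain S where S: "S > 0"
      "\<forall>\<^sub>F t in at_top. \<forall>x\<in>ball 0 (max R1 R2). \<forall>y\<in>ball 0 (max R1 R2). \<bar>G (t + S) t f x - T S f y\<bar> \<le> e / 8"
      "\<And>t x. t > \<tau> \<Longrightarrow> \<bar>G (t + S) t f x\<bar> \<le> M" "\<And>x. \<bar>T S f x\<bar> \<le> M"
    using evolution_merges_with_semigroup[OF fc M(2) u v, of "e / 8" "max R1 R2"] e by auto
  from S(2) eventually_gt_at_top[of \<tau>]
  show "\<forall>\<^sub>F t in at_top. dist (LINT x|\<mu> t. f x) (LINT x|m. f x) < e"
  proof eventually_elim
    case (elim t)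
    define z where "z = T S f 0"
    have 0: "0 \<in> ball (0 :: real^'n) (max R1 R2)" using R1 by simp
    have slice: "continuous_on UNIV (w (s + S))" if "bounded_classical_solution A s f w" for A s w
    proof -
      have "continuous_on ({s..} \<times> UNIV) (\<lambda>(t, x). w t x)" using that by (simp add: bounded_classical_solution_def)
      from continuous_on_compose2[OF this, of UNIV "\<lambda>x. (s + S, x)"] show ?thesis
        using S(1) by (force intro!: continuous_intros)
    qed
    have "\<bar>(LINT x|\<mu> (t + S). G (t + S) t f x) - z\<bar> \<le> e / 8 + 2 * M * \<epsilon>"
    proof (rule integral_near_constant)
      show "borel_prob (\<mu> (t + S))" using mu elim(2) S(1) by (simp add: evolution_system_of_measures_def)
      show "continuous_on UNIV (G (t + S) t f)" using slice[OF u[OF elim(2)]] .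
      show "\<bar>G (t + S) t f x - z\<bar> \<le> e / 8" if "x \<in> ball 0 R1" for x
        using elim(1) that 0 by (auto simp: z_def)
      show "measure (\<mu> (t + S)) (- ball 0 R1) \<le> \<epsilon>" using R1(2) elim(2) S(1) by simp
    qed (use S elim e in \<open>auto simp: z_def\<close>)
    moreover have "(LINT x|\<mu> (t + S). G (t + S) t f x) = (LINT x|\<mu> t. f x)"
      using mu f elim(2) S(1) by (simp add: evolution_system_of_measures_def)
    moreover have "\<bar>(LINT x|m. T S f x) - z\<bar> \<le> 2 * (e / 8) + 2 * M * \<epsilon>"
    proof (rule integral_near_constant[OF mprob])
      show "continuous_on UNIV (T S f)" using slice[OF v] by simp
      show "\<bar>T S f y - z\<bar> \<le> 2 * (e / 8)" if "y \<in> ball 0 R2" for y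
      proof -
        have y: "y \<in> ball 0 (max R1 R2)" using that by auto
        from elim(1)[rule_format, OF 0 y] elim(1)[rule_format, OF 0 0] show ?thesis unfolding z_def by linarith
      qed
    qed (use S R2 e in \<open>auto simp: z_def\<close>)
    moreover have "(LINT x|m. T S f x) = (LINT x|m. f x)"
      using m f S(1) by (simp add: invariant_measure_def)
    ultimately show ?case using \<epsilon>(2) e unfolding dist_real_def by linarith
  qed
qed

end

section \<open>Convergence of the evolution system of measures\<close>

text \<open>At equal times the time increment contributes \<open>0 powr (\<alpha> / 2) = 0\<close>.\<close>

lemma parabolic_holder_loc_imp_continuous_on:
  assumes h: "parabolic_holder_loc \<alpha> I w" and t: "t \<in> I" and \<alpha>: "0 < \<alpha>"
  shows "continuous_on UNIV (w t)"
proof -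
  have "isCont (w t) x" for x
  proof -
    have "compact ({t} \<times> cball x 1)" by (intro compact_Times compact_cball) auto
    moreover have "{t} \<times> cball x 1 \<subseteq> I \<times> UNIV" using t by auto
    ultimately obtain C where C: "\<And>y. y \<in> cball x 1 \<Longrightarrow> \<bar>w t y - w t x\<bar> \<le> C * norm (y - x) powr \<alpha>"
      using h unfolding parabolic_holder_loc_def by fastforce
    have "((\<lambda>y. C * norm (y - x) powr \<alpha>) \<longlongrightarrow> C * norm (x - x) powr \<alpha>) (at x)"
      using \<alpha> by (intro tendsto_intros tendsto_powr') auto
    then have "((\<lambda>y. C * norm (y - x) powr \<alpha>) \<longlongrightarrow> 0) (at x)" by simp
    then have "((\<lambda>y. w t y - w t x) \<longlongrightarrow> 0) (at x)"
      by (rule Lim_null_comparison[rotated])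
        (auto simp: eventually_at dist_norm norm_minus_commute intro!: exI[of _ 1] C)
    then show ?thesis by (simp add: isCont_def LIM_zero_iff)
  qed
  then show ?thesis by (simp add: continuous_at_imp_continuous_on)
qed

lemma holder_loc_imp_continuous_on:
  fixes w :: "'a::heine_borel \<Rightarrow> real"
  assumes h: "holder_loc \<alpha> UNIV w" and \<alpha>: "0 < \<alpha>"
  shows "continuous_on UNIV w"
proof -
  have "isCont w x" for x
  proof -
    obtain C where "\<forall>y\<in>cball x 1. \<forall>z\<in>cball x 1. \<bar>w y - w z\<bar> \<le> C * dist y z powr \<alpha>"
      using h compact_cball[of x 1] unfolding holder_loc_def by blast
    then have C: "\<bar>w y - w x\<bar> \<le> C * dist y x powr \<alpha>" if "y \<in> cball x 1" for y
      using that by simp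
    have "((\<lambda>y. C * dist y x powr \<alpha>) \<longlongrightarrow> C * dist x x powr \<alpha>) (at x)"
      using \<alpha> by (intro tendsto_intros tendsto_powr') auto
    then have "((\<lambda>y. C * dist y x powr \<alpha>) \<longlongrightarrow> 0) (at x)" by simp
    then have "((\<lambda>y. w y - w x) \<longlongrightarrow> 0) (at x)"
      by (rule Lim_null_comparison[rotated])
        (auto simp: eventually_at dist_commute intro!: exI[of _ 1] C)
    then show ?thesis by (simp add: isCont_def LIM_zero_iff)
  qed
  then show ?thesis by (simp add: continuous_at_imp_continuous_on)
qed

theorem theorem6p2:
  fixes I :: "real set"
    and Q :: "real \<Rightarrow> real^'n^('n::finite)"
    and b :: "real \<Rightarrow> real^'n \<Rightarrow> real^'n"
    and \<alpha> \<eta>\<^sub>0 \<Lambda> a c r\<^sub>0 :: real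
    and \<phi> :: "real^'n \<Rightarrow> real"
    and Qlim :: "real^'n^'n"
    and blim :: "real^'n \<Rightarrow> real^'n"
    and G :: "real \<Rightarrow> real \<Rightarrow> (real^'n \<Rightarrow> real) \<Rightarrow> real^'n \<Rightarrow> real"
    and T :: "real \<Rightarrow> (real^'n \<Rightarrow> real) \<Rightarrow> real^'n \<Rightarrow> real"
    and \<mu> :: "real \<Rightarrow> (real^'n) measure"
    and m :: "(real^'n) measure"
    and f :: "real^'n \<Rightarrow> real"
  assumes halfline: "\<exists>\<tau>. I = {\<tau><..}"
    and alpha: "0 < \<alpha>" "\<alpha> < 1"
    and Q_holder: "\<And>i j. holder_loc (\<alpha> / 2) I (\<lambda>t. Q t $ i $ j)"
    and b_holder: "\<And>i. parabolic_holder_loc \<alpha> I (\<lambda>t x. b t x $ i)"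
    and Q_sym: "\<And>t. t \<in> I \<Longrightarrow> transpose (Q t) = Q t"
    and ell_consts: "0 < \<eta>\<^sub>0" "\<eta>\<^sub>0 < \<Lambda>"
    and Q_ell: "\<And>t \<xi>. t \<in> I \<Longrightarrow>
          \<eta>\<^sub>0 * (norm \<xi>)\<^sup>2 \<le> (Q t *v \<xi>) \<bullet> \<xi> \<and> (Q t *v \<xi>) \<bullet> \<xi> \<le> \<Lambda> * (norm \<xi>)\<^sup>2"
    and phi_C2: "C2 \<phi>"
    and phi_pos: "\<And>x. 0 < \<phi> x"
    and lyap_consts: "0 < a" "0 < c"
    and phi_lim: "filterlim \<phi> at_top at_infinity"
    and phi_lyap: "\<And>t x. t \<in> I \<Longrightarrow> kolmogorov_op (Q t) (b t) \<phi> x \<le> a - c * \<phi> x"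
    and b_diff: "\<And>t x i j. t \<in> I \<Longrightarrow> has_partial j (\<lambda>y. b t y $ i) x"
    and b_diff_holder: "\<And>i j. parabolic_holder_loc \<alpha> I (\<lambda>t. partial j (\<lambda>y. b t y $ i))"
    and r0_neg: "r\<^sub>0 < 0"
    and b_diss: "\<And>t x \<xi>. t \<in> I \<Longrightarrow> (jacobian_matrix (b t) x *v \<xi>) \<bullet> \<xi> \<le> r\<^sub>0 * (norm \<xi>)\<^sup>2"
    and b_bdd: "\<And>r. 0 < r \<Longrightarrow>
          \<exists>t\<^sub>0\<in>I. bdd_above ((\<lambda>(t, x). norm (b t x)) ` ({t\<^sub>0<..} \<times> ball 0 r))"
    and Q_lim: "(Q \<longlongrightarrow> Qlim) at_top"
    and b_lim_holder: "\<And>j. holder_loc \<alpha> UNIV (\<lambda>x. blim x $ j)"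
    and b_lim: "\<And>j x. ((\<lambda>t. b t x $ j) \<longlongrightarrow> blim x $ j) at_top"
    and G: "evolution_operator I (\<lambda>t. kolmogorov_op (Q t) (b t)) G"
    and mu: "evolution_system_of_measures I G \<mu>"
    and mu_tight: "tight_family I \<mu>"
    and T: "markov_semigroup (kolmogorov_op Qlim blim) T"
    and m: "invariant_measure T m"
    and f: "f \<in> bcontfun"
  shows "((\<lambda>t. LINT x|\<mu> t. f x) \<longlongrightarrow> (LINT x|m. f x)) at_top"
proof -
  obtain \<tau> where I: "I = {\<tau><..}" using halfline by blast
  interpret asymptotically_autonomous \<tau> a c \<eta>\<^sub>0 r\<^sub>0 Q Qlim b blim \<phi> "grad \<phi>" "hessian \<phi>"
  proof
    show "transpose (Q t) = Q t" if "t > \<tau>" for t using Q_sym that I by simp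
    show "0 < \<eta>\<^sub>0" "(Q \<longlongrightarrow> Qlim) at_top" "filterlim \<phi> at_top at_infinity" "0 < c" "0 \<le> a" "r\<^sub>0 < 0"
      using ell_consts Q_lim phi_lim lyap_consts r0_neg by auto
    show "\<eta>\<^sub>0 * (norm \<xi>)\<^sup>2 \<le> \<xi> \<bullet> (Q t *v \<xi>)" if "t > \<tau>" for t \<xi>
      using Q_ell[of t \<xi>] that I by (simp add: inner_commute)
    show "continuous_on UNIV \<phi>" using phi_C2 by (simp add: C2_def)
    show "0 \<le> \<phi> x" for x using phi_pos[of x] by simp
    show "second_order_jet \<phi> x (grad \<phi> x) (hessian \<phi> x)" for x
      using phi_C2 by (intro second_order_jet_if_continuous_partials) (auto simp: C2_def)
    show "trace (Q t ** hessian \<phi> x) + b t x \<bullet> grad \<phi> x \<le> a - c * \<phi> x" if "t > \<tau>" for t x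
      using phi_lyap[of t x] that I by (simp add: kolmogorov_op_def)
    show "(b t x - b t y) \<bullet> (x - y) \<le> r\<^sub>0 * (norm (x - y))\<^sup>2" if "t > \<tau>" for t x y
    proof (rule one_sided_lipschitz_if_jacobian)
      have t: "t \<in> I" using that I by simp
      show "has_partial j (\<lambda>y. b t y $ i) x" for i j x by (rule b_diff[OF t])
      show "continuous_on UNIV (partial j (\<lambda>y. b t y $ i))" for i j
        by (rule parabolic_holder_loc_imp_continuous_on[OF b_diff_holder t alpha(1)])
      show "(jacobian_matrix (b t) x *v \<xi>) \<bullet> \<xi> \<le> r\<^sub>0 * (norm \<xi>)\<^sup>2" for x \<xi> by (rule b_diss[OF t])
    qed
    show "\<exists>t\<^sub>0 C. \<forall>t>t\<^sub>0. \<forall>x\<in>ball 0 R. norm (b t x) \<le> C" for R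
    proof (cases "R > 0")
      case True
      from b_bdd[OF this] obtain t\<^sub>0 C where
        "\<And>z. z \<in> (\<lambda>(t, x). norm (b t x)) ` ({t\<^sub>0<..} \<times> ball 0 R) \<Longrightarrow> z \<le> C"
        unfolding bdd_above_def by blast
      then have "norm (b t x) \<le> C" if "t > t\<^sub>0" "x \<in> ball 0 R" for t x using that by force
      then show ?thesis by blast
    next
      case False
      then have empty: "ball (0 :: real^'n) R = {}" by simp
      show ?thesis unfolding empty by simp
    qed
    show "((\<lambda>t. b t x) \<longlongrightarrow> blim x) at_top" for x by (intro vec_tendstoI b_lim)
    have "continuous_on UNIV (\<lambda>x. \<chi> j. blim x $ j)"
      by (intro continuous_on_vec_lambda holder_loc_imp_continuous_on[OF b_lim_holder alpha(1)])
    then show "continuous_on UNIV blim" by simp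
  qed
  show ?thesis
    using evolution_measures_tendsto_invariant_measure f G mu mu_tight T m unfolding I by blast
qed

end
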